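(* Let $1\le p,q<\infty$, $\alpha>-1$ and $t>0$. The following statements are equivalent: (i) $I_t$ is bounded from $\{f\in\mathcal{H}^p:\ \text{first coefficient of } f \text{ is zero}\}$ (with the $\mathcal{H}^p$-norm) into $\mathcal{A}^q_\alpha$. (ii) The identity map $\mathrm{Id}:\mathcal{H}^p\to\mathcal{A}^q_{\alpha+qt}$ is (well defined and) bounded. (iii) $p\ge q$.
   Context: A Dirichlet polynomial is a finite sum $P(s)=\sum_{n=1}^N a_n n^{-s}$. The infinite torus $\mathbb{T}^\infty$, with normalized Haar measure $m_\infty$, is identified with the group of completely multiplicative maps $\chi:\mathbb{N}\to\{|z|=1\}$. For $1\le p<\infty$, $\|P\|_{\mathcal{H}^p}=\big(\int_{\mathbb{T}^\infty}|\sum_{n} a_n\chi(n)|^p\,dm_\infty(\chi)\big)^{1/p}$, and $P_\sigma(s)=P(s+\sigma)$ for $\sigma\ge 0$. The space $\mathcal{H}^p$ is the completion of the Dirichlet polynomials in $\|\cdot\|_{\mathcal{H}^p}$. For $\beta>-1$, let $d\mu_\beta(\sigma)=\frac{2^{\beta+1}}{\Gamma(\beta+1)}\sigma^\beta e^{-2\sigma}\,d\sigma$ on $(0,\infty)$ and $\|P\|_{\mathcal{A}^q_\beta}=\big(\int_0^\infty\|P_\sigma\|_{\mathcal{H}^q}^q\,d\mu_\beta(\sigma)\big)^{1/q}$. The space $\mathcal{A}^q_\beta$ is the completion of the Dirichlet polynomials in this norm. Elements of $\mathcal{H}^p$ and $\mathcal{A}^q_\beta$ are identified with Dirichlet series $\sum_{n\ge1}a_nn^{-s}$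 (coefficientwise limits of Cauchy sequences of Dirichlet polynomials), which converge in $\{\mathrm{Re}(s)>1/2\}$. The operator $I_t$, $t>0$, acts on Dirichlet series $f(s)=\sum_{n\ge2}a_nn^{-s}$ with first coefficient zero by $I_t(f)(s)=\frac1{\Gamma(t)}\int_0^\infty x^{t-1}f(x+s)\,dx$ on the half-plane of convergence, that is, $I_t(f)(s)=\sum_{n\ge2}\frac{a_n}{(\log n)^t}n^{-s}$. *)

theory Defs
  imports "HOL-Probability.Probability" "HOL-Computational_Algebra.Primes"
begin

text \<open>
  A Dirichlet series \<open>\<Sum>n\<ge>1. a n * n powr (-s)\<close> is represented by its coefficient sequence
  \<open>a :: nat \<Rightarrow> complex\<close>, with the convention \<open>a 0 = 0\<close>.
\<close>

definition dirichlet_polynomial :: "(nat \<Rightarrow> complex) \<Rightarrow> bool" where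
  "dirichlet_polynomial a \<longleftrightarrow> a 0 = 0 \<and> finite {n. a n \<noteq> 0}"

definition dirichlet_shift :: "real \<Rightarrow> (nat \<Rightarrow> complex) \<Rightarrow> nat \<Rightarrow> complex" where
  "dirichlet_shift \<sigma> a = (\<lambda>n. a n * complex_of_real (real n powr (-\<sigma>)))"

definition circle_measure :: "complex measure" where
  "circle_measure =
     distr (uniform_measure lborel {0..<2 * pi}) (restrict_space borel (sphere 0 1)) cis"

text \<open>
  The infinite torus is indexed by the primes; its normalized Haar measure is the product of the
  normalized arc length measures. A point \<open>z\<close> corresponds to the completely multiplicative
  map \<open>torus_char z\<close> with value \<open>z p\<close> at each prime \<open>p\<close>.
\<close>

definition torus_measure :: "(nat \<Rightarrow> complex) measure" where
  "torus_measure = (\<Pi>\<^sub>M p\<in>{p. prime p}. circle_measure)"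

definition torus_char :: "(nat \<Rightarrow> complex) \<Rightarrow> nat \<Rightarrow> complex" where
  "torus_char z n = (\<Prod>p\<in>prime_factors n. z p ^ multiplicity p n)"

definition hardy_poly_norm :: "real \<Rightarrow> (nat \<Rightarrow> complex) \<Rightarrow> real" where
  "hardy_poly_norm p a =
     (\<integral>z. cmod (\<Sum>n | a n \<noteq> 0. a n * torus_char z n) powr p \<partial>torus_measure) powr (1 / p)"

definition weight_measure :: "real \<Rightarrow> real measure" where
  "weight_measure \<beta> = density lborel (\<lambda>\<sigma>. ennreal
     (indicator {0<..} \<sigma> * (2 powr (\<beta> + 1) / Gamma (\<beta> + 1) * \<sigma> powr \<beta> * exp (-2 * \<sigma>))))"

definition bergman_poly_norm :: "real \<Rightarrow> real \<Rightarrow> (nat \<Rightarrow> complex) \<Rightarrow> real" where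
  "bergman_poly_norm q \<beta> a =
     (\<integral>\<sigma>. hardy_poly_norm q (dirichlet_shift \<sigma> a) powr q \<partial>weight_measure \<beta>) powr (1 / q)"

text \<open>
  Completion of the Dirichlet polynomials with respect to a norm \<open>N\<close>, realised as a space of
  Dirichlet series: its elements are the coefficientwise limits of \<open>N\<close>-Cauchy sequences of
  Dirichlet polynomials, and the norm of an element is the limit of the norms along any
  such sequence. The latter is unambiguous for the norms used here, in which a Cauchy
  sequence of polynomials whose coefficients all tend to 0 tends to 0 in norm.
\<close>

definition approximates ::
    "((nat \<Rightarrow> complex) \<Rightarrow> real) \<Rightarrow> (nat \<Rightarrow> nat \<Rightarrow> complex) \<Rightarrow> (nat \<Rightarrow> complex) \<Rightarrow> bool" where
  "approximates N P f \<longleftrightarrow>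
     (\<forall>k. dirichlet_polynomial (P k)) \<and>
     (\<forall>\<epsilon>>0. \<exists>K. \<forall>i\<ge>K. \<forall>j\<ge>K. N (\<lambda>n. P i n - P j n) < \<epsilon>) \<and>
     (\<forall>n. (\<lambda>k. P k n) \<longlonglongrightarrow> f n)"

definition completion_space :: "((nat \<Rightarrow> complex) \<Rightarrow> real) \<Rightarrow> (nat \<Rightarrow> complex) set" where
  "completion_space N = {f. \<exists>P. approximates N P f}"

definition completion_norm :: "((nat \<Rightarrow> complex) \<Rightarrow> real) \<Rightarrow> (nat \<Rightarrow> complex) \<Rightarrow> real" where
  "completion_norm N f = (THE L. \<forall>P. approximates N P f \<longrightarrow> (\<lambda>k. N (P k)) \<longlonglongrightarrow> L)"

definition hardy_space :: "real \<Rightarrow> (nat \<Rightarrow> complex) set" where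
  "hardy_space p = completion_space (hardy_poly_norm p)"

definition hardy_norm :: "real \<Rightarrow> (nat \<Rightarrow> complex) \<Rightarrow> real" where
  "hardy_norm p = completion_norm (hardy_poly_norm p)"

definition hardy_space_0 :: "real \<Rightarrow> (nat \<Rightarrow> complex) set" where
  "hardy_space_0 p = {f \<in> hardy_space p. f 1 = 0}"

definition bergman_space :: "real \<Rightarrow> real \<Rightarrow> (nat \<Rightarrow> complex) set" where
  "bergman_space q \<beta> = completion_space (bergman_poly_norm q \<beta>)"

definition bergman_norm :: "real \<Rightarrow> real \<Rightarrow> (nat \<Rightarrow> complex) \<Rightarrow> real" where
  "bergman_norm q \<beta> = completion_norm (bergman_poly_norm q \<beta>)"

definition bounded_map ::
    "'a set \<Rightarrow> ('a \<Rightarrow> real) \<Rightarrow> 'b set \<Rightarrow> ('b \<Rightarrow> real) \<Rightarrow> ('a \<Rightarrow> 'b) \<Rightarrow> bool" where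
  "bounded_map X NX Y NY T \<longleftrightarrow> T ` X \<subseteq> Y \<and> (\<exists>C. \<forall>f\<in>X. NY (T f) \<le> C * NX f)"

definition int_op :: "real \<Rightarrow> (nat \<Rightarrow> complex) \<Rightarrow> nat \<Rightarrow> complex" where
  "int_op t a = (\<lambda>n. if n \<ge> 2 then a n / complex_of_real (ln (real n) powr t) else 0)"

text \<open>
  The coefficient formula for \<open>int_op\<close> agrees with the integral
  \<open>1 / Gamma t * (\<integral> x powr (t - 1) * f (x + s) dx)\<close> over the positive half-line, wherever the
  series \<open>f\<close> converges absolutely.
\<close>

lemma has_bochner_integral_powr_exp:
  fixes c t :: real
  assumes c: "c > 0" and t: "t > 0"
  shows "has_bochner_integral lborel
           (\<lambda>x. indicator {0<..} x * (x powr (t - 1) * exp (- c * x))) (Gamma t / c powr t)"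
proof -
  define f where "f = (\<lambda>x::real. indicator {0..} x * x powr (t - 1) / exp x)"
  have "has_bochner_integral lborel f (Gamma t)"
  proof (rule has_bochner_integral_nn_integral)
    show "(\<integral>\<^sup>+ x. ennreal (f x) \<partial>lborel) = ennreal (Gamma t)"
      unfolding f_def using Gamma_conv_nn_integral_real[OF t] by simp
  qed (use t in \<open>auto simp: f_def Gamma_real_pos less_imp_le\<close>)
  hence "has_bochner_integral lborel (\<lambda>x. f (0 + c * x)) (Gamma t /\<^sub>R \<bar>c\<bar>)"
    using c by (subst (asm) lborel_has_bochner_integral_real_affine_iff[of c _ _ 0]) auto
  hence "has_bochner_integral lborel (\<lambda>x. c powr (1 - t) * f (0 + c * x))
           (c powr (1 - t) * (Gamma t /\<^sub>R \<bar>c\<bar>))"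
    by (rule has_bochner_integral_mult_right)
  moreover have "c powr (1 - t) * f (0 + c * x)
                   = indicator {0<..} x * (x powr (t - 1) * exp (- c * x))" for x
  proof (cases "x > 0")
    case True
    have "c powr (1 - t) * (c powr (t - 1) * x powr (t - 1)) = x powr (t - 1)"
      using c by (simp flip: mult.assoc powr_add)
    with True c show ?thesis
      by (simp add: f_def powr_mult exp_minus field_simps)
  next
    case False
    with c have "x = 0 \<or> c * x < 0" by (auto simp: mult_less_0_iff)
    with False show ?thesis by (auto simp: f_def)
  qed
  moreover have "c powr (1 - t) * (Gamma t /\<^sub>R \<bar>c\<bar>) = Gamma t / c powr t"
    using c by (simp add: powr_diff field_simps)
  ultimately show ?thesis by simp
qed

lemma int_op_eq_integral:
  fixes a :: "nat \<Rightarrow> complex" and s :: complex and t :: real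
  assumes t: "t > 0" and a: "a 0 = 0" "a 1 = 0"
    and summ: "summable (\<lambda>n. norm (a n * of_nat n powr (- s)))"
  shows "(\<Sum>n. int_op t a n * of_nat n powr (- s)) =
           1 / complex_of_real (Gamma t) *
           (LINT x:{0<..}|lborel. complex_of_real (x powr (t - 1)) *
              (\<Sum>n. a n * of_nat n powr (- (of_real x + s))))"
proof -
  define h :: "nat \<Rightarrow> real \<Rightarrow> real" where
    "h = (\<lambda>n x. indicator {0<..} x * (x powr (t - 1) * exp (- ln (real n) * x)))"
  define b where "b = (\<lambda>n. a n * of_nat n powr (- s))"
  define F where "F = (\<lambda>n x. b n * complex_of_real (h n x))"
  have b0: "b n = 0" if "n < 2" for n
    using that a by (cases n) (auto simp: b_def)
  have h: "has_bochner_integral lborel (h n) (Gamma t / ln (real n) powr t)" if "n \<ge> 2" for n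
    unfolding h_def using that t by (intro has_bochner_integral_powr_exp) auto
  have F: "has_bochner_integral lborel (F n)
             (b n * complex_of_real (Gamma t / ln (real n) powr t))" for n
  proof (cases "n \<ge> 2")
    case True
    thus ?thesis unfolding F_def
      by (intro has_bochner_integral_mult_right has_bochner_integral_of_real h)
  qed (simp add: F_def b0 has_bochner_integral_zero)
  have h_nonneg: "h n x \<ge> 0" for n x by (simp add: h_def)
  have nF: "(\<integral>x. norm (F n x) \<partial>lborel) = norm (b n) * (Gamma t / ln (real n) powr t)" for n
  proof (cases "n \<ge> 2")
    case True
    have "(\<integral>x. norm (F n x) \<partial>lborel) = (\<integral>x. norm (b n) * h n x \<partial>lborel)"
      using h_nonneg by (simp add: F_def norm_mult)
    also have "\<dots> = norm (b n) * (Gamma t / ln (real n) powr t)"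
      using has_bochner_integral_integral_eq[OF h[OF True]] by simp
    finally show ?thesis .
  qed (simp add: F_def b0)
  have summ_b: "summable (\<lambda>n. norm (b n))" using summ by (simp add: b_def)
  have h_le: "norm (F n x) \<le> norm (b n) * x powr (t - 1)" for n x
  proof (cases "n \<ge> 2 \<and> x > 0")
    case True
    hence "exp (- ln (real n) * x) \<le> 1" by simp
    hence "h n x \<le> x powr (t - 1)"
      using True by (simp add: h_def mult_left_le)
    thus ?thesis using h_nonneg[of n x]
      by (simp add: F_def norm_mult mult_left_mono)
  qed (auto simp: F_def h_def b0 not_le)
  have int_bd: "norm (b n) * (Gamma t / ln (real n) powr t)
                  \<le> norm (b n) * (Gamma t / ln 2 powr t)" for n
  proof (cases "n \<ge> 2")
    case True
    hence "ln 2 powr t \<le> ln (real n) powr t"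
      using t by (intro powr_mono2) auto
    thus ?thesis using t True
      by (intro mult_left_mono divide_left_mono) (auto simp: Gamma_real_pos less_imp_le)
  qed (simp add: b0)
  have "(\<integral>x. (\<Sum>n. F n x) \<partial>lborel) = (\<Sum>n. integral\<^sup>L lborel (F n))"
  proof (rule integral_suminf)
    show "AE x in lborel. summable (\<lambda>n. norm (F n x))"
    proof (intro AE_I2)
      fix x show "summable (\<lambda>n. norm (F n x))"
        by (rule summable_comparison_test'[OF summable_mult2[OF summ_b, of "x powr (t - 1)"], of 0])
           (use h_le in auto)
    qed
    show "summable (\<lambda>n. \<integral>x. norm (F n x) \<partial>lborel)"
      by (rule summable_comparison_test'[OF summable_mult2[OF summ_b, of "Gamma t / ln 2 powr t"], of 0])
         (use int_bd t in \<open>auto simp: nF abs_mult Gamma_real_pos less_imp_le\<close>)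
  qed (use F in \<open>auto simp: has_bochner_integral_iff\<close>)
  also have "(\<lambda>n. integral\<^sup>L lborel (F n))
               = (\<lambda>n. complex_of_real (Gamma t) * (int_op t a n * of_nat n powr (- s)))"
    using has_bochner_integral_integral_eq[OF F] a b0
    by (auto simp: fun_eq_iff int_op_def b_def)
  also have "(\<Sum>n. complex_of_real (Gamma t) * (int_op t a n * of_nat n powr (- s)))
               = complex_of_real (Gamma t) * (\<Sum>n. int_op t a n * of_nat n powr (- s))"
  proof (rule suminf_mult)
    have "norm (int_op t a n * of_nat n powr (- s)) \<le> norm (b n) * (1 / ln 2 powr t)" for n
    proof (cases "n \<ge> 2")
      case True
      hence "ln 2 powr t \<le> ln (real n) powr t"
        using t by (intro powr_mono2) auto
      hence "norm (b n) * (1 / ln (real n) powr t) \<le> norm (b n) * (1 / ln 2 powr t)"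
        using True by (intro mult_left_mono divide_left_mono) auto
      thus ?thesis using True by (simp add: int_op_def b_def norm_mult norm_divide)
    qed (simp add: int_op_def)
    thus "summable (\<lambda>n. int_op t a n * of_nat n powr (- s))"
      by (intro summable_comparison_test'[OF summable_mult2[OF summ_b, of "1 / ln 2 powr t"], of 0])
  qed
  finally have eq: "(\<integral>x. (\<Sum>n. F n x) \<partial>lborel)
      = complex_of_real (Gamma t) * (\<Sum>n. int_op t a n * of_nat n powr (- s))" .
  have "(\<Sum>n. F n x) = indicator {0<..} x *\<^sub>R (complex_of_real (x powr (t - 1)) *
          (\<Sum>n. a n * of_nat n powr (- (of_real x + s))))" for x
  proof (cases "x > 0")
    case x: True
    have F_eq: "F n x = complex_of_real (x powr (t - 1)) *
                   (a n * of_nat n powr (- (of_real x + s)))" for n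
    proof (cases "n \<ge> 2")
      case True
      hence "of_nat n powr (- (of_real x + s)) =
               of_nat n powr (- s) * complex_of_real (exp (- ln (real n) * x))"
        by (simp add: powr_def Ln_of_nat exp_of_real[symmetric] algebra_simps flip: exp_add)
      thus ?thesis using x by (simp add: F_def b_def h_def)
    next
      case False
      hence "n = 0 \<or> n = 1" by auto
      thus ?thesis using a by (auto simp: F_def b_def)
    qed
    have "summable (\<lambda>n. a n * of_nat n powr (- (of_real x + s)))"
    proof (rule summable_comparison_test'[OF summ_b, of 0])
      fix n
      show "norm (a n * of_nat n powr (- (of_real x + s))) \<le> norm (b n)"
      proof (cases "n \<ge> 2")
        case True
        hence "norm (of_nat n powr (- (of_real x + s))) \<le> norm (of_nat n powr (- s) :: complex)"
          using x by (simp add: norm_powr_real_powr)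
        thus ?thesis by (simp add: b_def norm_mult mult_left_mono)
      next
        case False
        hence "n = 0 \<or> n = 1" by auto
        thus ?thesis using a by auto
      qed
    qed
    thus ?thesis using x by (simp add: F_eq suminf_mult)
  qed (simp add: F_def h_def)
  hence "(LINT x:{0<..}|lborel. complex_of_real (x powr (t - 1)) *
            (\<Sum>n. a n * of_nat n powr (- (of_real x + s)))) = (\<integral>x. (\<Sum>n. F n x) \<partial>lborel)"
    by (simp add: set_lebesgue_integral_def)
  moreover have "Gamma t \<noteq> 0" using Gamma_real_pos[OF t] by simp
  ultimately show ?thesis by (simp add: eq)
qed

end

theory Submission
  imports Defs "HOL-Complex_Analysis.Complex_Analysis" "HOL-Real_Asymp.Real_Asymp"
    "HOL-Computational_Algebra.Squarefree"
begin

text \<open>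
  Multipliers of Dirichlet polynomials are controlled by their action on exponential sums
  \<open>\<Sum> c n * cis (- \<tau> * ln n)\<close> that are bounded on the imaginary axis; by duality and invariance of Haar
  measure the same bounds hold in every \<open>H\<^sup>q\<close>. Thus shifts to the right are contractions and
  \<open>I\<^sub>t\<close> is bounded on \<open>H\<^sup>q\<close>, so (i) and (ii) hold if \<open>q \<le> p\<close>. On polynomials with spectrum in \<open>{2..N}\<close>,
  undoing a shift costs \<open>N powr \<sigma>\<close> and undoing \<open>I\<^sub>t\<close> costs a power of \<open>ln N\<close>, so that the norms in (i) and
  (ii) differ from the \<open>H\<^sup>q\<close> norm at most by a power of \<open>ln N\<close>. For \<open>p < q\<close> the products of
  \<open>1 + r powr (- s)\<close> over the \<open>k\<close> primes \<open>r\<close> up to a power of 4 violate this: the quotient of their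
  \<open>H\<^sup>q\<close> and \<open>H\<^sup>p\<close> norms is exponential in \<open>k\<close>, while \<open>ln N\<close> is at most quadratic in \<open>k\<close>.
\<close>

section \<open>Multipliers for exponential sums\<close>

text \<open>Statements (i) and (ii) are never compared with each other; each is tied to (iii)
  separately. A direct comparison would be a Littlewood-Paley type estimate. It can be avoided
  because the obstruction for p < q is exponential, so losing powers of \<open>ln N\<close> does no
  harm. That obstruction comes from a single variable: |1 + z| is not constant on the circle, so its
  L^q norm strictly exceeds its L^p norm, and independence of the coordinates raises this quotient
  to the k-th power. Undoing shifts costs only a power of \<open>ln N\<close> because N^\<sigma>
  stays bounded for \<sigma> < 1 / ln N, a range whose mass under the weight is of order (ln
  N)^-(\<beta> + 1). A second obstacle is the completion: its elements are coefficient sequences and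
  its norm is defined by THE, so before any estimate passes from polynomials to the spaces, a Cauchy
  sequence with vanishing coefficients must be shown to be a null sequence.\<close>

text \<open>
  The factor \<open>1 / (1 + \<epsilon> s)\<close> forces decay at infinity, so that the maximum modulus principle
  applies on a large half disc.
\<close>

lemma half_plane_maximum_principle:
  fixes h :: "complex \<Rightarrow> complex"
  assumes hol: "h holomorphic_on UNIV"
    and bdd: "\<And>s. Re s \<ge> 0 \<Longrightarrow> cmod (h s) \<le> M"
    and axis: "\<And>\<tau>. cmod (h (\<i> * of_real \<tau>)) \<le> B"
    and s: "Re s \<ge> 0"
  shows "cmod (h s) \<le> B"
proof -
  have B0: "B \<ge> 0" using axis[of 0] norm_ge_zero order_trans by blast
  have M0: "M \<ge> 0" using bdd[of 0] norm_ge_zero order_trans by (metis order_refl zero_complex.sel(1))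
  have den: "cmod (1 + of_real \<epsilon> * z) \<ge> 1" "cmod (1 + of_real \<epsilon> * z) \<ge> \<epsilon> * cmod z"
    if "\<epsilon> > 0" "Re z \<ge> 0" for \<epsilon> z
  proof -
    show "cmod (1 + of_real \<epsilon> * z) \<ge> 1"
      using complex_Re_le_cmod[of "1 + of_real \<epsilon> * z"] that by simp (smt (verit) mult_nonneg_nonneg)
    have "(cmod (1 + of_real \<epsilon> * z))\<^sup>2 \<ge> (\<epsilon> * cmod z)\<^sup>2"
    proof -
      have "(cmod (1 + of_real \<epsilon> * z))\<^sup>2 = 1 + 2 * \<epsilon> * Re z + \<epsilon>\<^sup>2 * ((Re z)\<^sup>2 + (Im z)\<^sup>2)"
        unfolding cmod_power2 by (simp add: power2_eq_square algebra_simps)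
      moreover have "(\<epsilon> * cmod z)\<^sup>2 = \<epsilon>\<^sup>2 * ((Re z)\<^sup>2 + (Im z)\<^sup>2)"
        by (simp add: power_mult_distrib cmod_power2)
      moreover have "2 * \<epsilon> * Re z \<ge> 0" using that by simp
      ultimately show ?thesis by linarith
    qed
    thus "cmod (1 + of_real \<epsilon> * z) \<ge> \<epsilon> * cmod z"
      by (rule power2_le_imp_le) simp
  qed
  have eps: "cmod (h s / (1 + of_real \<epsilon> * s)) \<le> B + \<epsilon>" if e: "\<epsilon> > 0" for \<epsilon>
  proof -
    \<comment> \<open>On the arc |z| = R the quotient is at most M / (\<epsilon> * R), which is at
      most \<epsilon> once R >= M / \<epsilon>^2. R also exceeds |s|, so that s lies in the half
      disc.\<close>
    define R where "R = max (cmod s) (M / \<epsilon>\<^sup>2) + 1"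
    have R: "R > 0" "cmod s \<le> R" "M / \<epsilon>\<^sup>2 \<le> R"
      unfolding R_def by (auto simp: max_def intro: add_nonneg_pos order_trans[of 0 "cmod s"])
       (smt (verit) norm_ge_zero)
    define S where "S = cball 0 R \<inter> {z::complex. Re z \<ge> 0}"
    have clS: "closed S" unfolding S_def
      by (intro closed_Int closed_cball closed_halfspace_Re_ge)
    have hol': "(\<lambda>z. h z / (1 + of_real \<epsilon> * z)) holomorphic_on S"
      unfolding S_def
    proof (intro holomorphic_intros holomorphic_on_subset[OF hol] subset_UNIV)
      fix z assume "z \<in> cball 0 R \<inter> {z. 0 \<le> Re z}"
      thus "1 + of_real \<epsilon> * z \<noteq> 0" using den(1)[OF e, of z] by auto
    qed
    show ?thesis
    proof (rule maximum_modulus_frontier[where S = S and f = "\<lambda>z. h z / (1 + of_real \<epsilon> * z)"])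
      show "(\<lambda>z. h z / (1 + of_real \<epsilon> * z)) holomorphic_on interior S"
        using hol' interior_subset by (rule holomorphic_on_subset)
      show "continuous_on (closure S) (\<lambda>z. h z / (1 + of_real \<epsilon> * z))"
        using hol' clS by (simp add: holomorphic_on_imp_continuous_on)
      show "bounded S" unfolding S_def by (intro bounded_Int disjI1 bounded_cball)
      show "s \<in> S" using s R by (simp add: S_def)
      fix z assume z: "z \<in> frontier S"
      have zS: "z \<in> S" using z clS by (simp add: frontier_def)
      hence Rez: "Re z \<ge> 0" by (simp add: S_def)
      have "z \<notin> ball 0 R \<inter> {z. Re z > 0}"
      proof
        assume "z \<in> ball 0 R \<inter> {z. Re z > 0}"
        moreover have "open (ball 0 R \<inter> {z. Re z > 0})"
          by (intro open_Int open_ball open_halfspace_Re_gt)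
        moreover have "ball 0 R \<inter> {z. Re z > 0} \<subseteq> S" by (auto simp: S_def)
        ultimately have "z \<in> interior S" by (meson interiorI)
        with z show False by (simp add: frontier_def)
      qed
      hence "Re z = 0 \<or> cmod z = R" using zS by (auto simp: S_def)
      thus "cmod (h z / (1 + of_real \<epsilon> * z)) \<le> B + \<epsilon>"
      proof
        assume "Re z = 0"
        hence "z = \<i> * of_real (Im z)" by (simp add: complex_eq_iff)
        hence "cmod (h z) \<le> B" using axis[of "Im z"] by simp
        moreover have "cmod (h z / (1 + of_real \<epsilon> * z)) \<le> cmod (h z) / 1"
          unfolding norm_divide using den(1)[OF e Rez] by (intro divide_left_mono) auto
        ultimately show ?thesis using e by simp
      next
        assume zR: "cmod z = R"
        have "cmod (h z / (1 + of_real \<epsilon> * z)) \<le> M / (\<epsilon> * R)"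
          unfolding norm_divide using den(2)[OF e Rez] bdd[OF Rez] R e zR M0
          by (intro frac_le) auto
        also have "\<dots> \<le> \<epsilon>" using R e by (simp add: field_simps power2_eq_square)
        finally show ?thesis using B0 by simp
      qed
    qed
  qed
  have "((\<lambda>\<epsilon>. cmod (h s / (1 + of_real \<epsilon> * s))) \<longlongrightarrow> cmod (h s / (1 + of_real 0 * s))) (at_right 0)"
    by (intro tendsto_intros) auto
  moreover have "((\<lambda>\<epsilon>. B + \<epsilon>) \<longlongrightarrow> B + 0) (at_right 0)"
    by (intro tendsto_intros)
  moreover have "\<forall>\<^sub>F \<epsilon> in at_right 0. cmod (h s / (1 + of_real \<epsilon> * s)) \<le> B + \<epsilon>"
    using eventually_at_right_less[of "0::real"] by (rule eventually_mono) (rule eps)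
  ultimately show ?thesis
    using tendsto_le[OF _ \<open>((\<lambda>\<epsilon>. B + \<epsilon>) \<longlongrightarrow> B + 0) (at_right 0)\<close>, of "\<lambda>\<epsilon>. cmod (h s / (1 + of_real \<epsilon> * s))"]
    by simp
qed

text \<open>Factoring out the lowest frequency \<Lambda> leaves nonnegative exponents, so the
  remaining sum is bounded on the half-plane, as the maximum principle demands. The factor is
  unimodular on the axis, so the bound B survives there. \<Lambda> may be negative, which covers
  reflected spectra.\<close>

lemma exponential_sum_half_plane:
  fixes u :: "'a \<Rightarrow> real" and c :: "'a \<Rightarrow> complex"
  assumes S: "finite S" "\<And>n. n \<in> S \<Longrightarrow> \<Lambda> \<le> u n"
    and B: "\<And>\<tau>. cmod (\<Sum>n\<in>S. c n * cis (- \<tau> * u n)) \<le> B"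
    and s: "Re s \<ge> 0"
  shows "cmod (\<Sum>n\<in>S. c n * exp (- s * of_real (u n))) \<le> B * exp (- \<Lambda> * Re s)"
proof -
  define h where "h = (\<lambda>s. \<Sum>n\<in>S. c n * exp (- s * of_real (u n - \<Lambda>)))"
  have h_eq: "h s = exp (s * of_real \<Lambda>) * (\<Sum>n\<in>S. c n * exp (- s * of_real (u n)))" for s
    unfolding h_def sum_distrib_left
    by (intro sum.cong refl) (simp add: algebra_simps flip: exp_add)
  have "cmod (h s) \<le> B"
  proof (rule half_plane_maximum_principle[OF _ _ _ s])
    show "h holomorphic_on UNIV" unfolding h_def by (intro holomorphic_intros)
    show "cmod (h s) \<le> (\<Sum>n\<in>S. cmod (c n))" if "Re s \<ge> 0" for s
      unfolding h_def
    proof (rule sum_norm_le)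
      fix n assume "n \<in> S"
      hence "0 \<le> Re s * (u n - \<Lambda>)" using S(2)[of n] that by simp
      hence "exp (- (Re s * (u n - \<Lambda>))) \<le> 1" by simp
      hence "cmod (c n) * exp (- (Re s * (u n - \<Lambda>))) \<le> cmod (c n)" by (intro mult_left_le) auto
      thus "cmod (c n * exp (- s * of_real (u n - \<Lambda>))) \<le> cmod (c n)"
        by (simp add: norm_mult)
    qed
    fix \<tau> :: real
    have "(\<Sum>n\<in>S. c n * exp (- (\<i> * of_real \<tau>) * of_real (u n))) = (\<Sum>n\<in>S. c n * cis (- \<tau> * u n))"
      by (simp add: cis_conv_exp mult.assoc)
    thus "cmod (h (\<i> * of_real \<tau>)) \<le> B"
      using B[of \<tau>] unfolding h_eq norm_mult by simp
  qed
  thus ?thesis unfolding h_eq norm_mult by (simp add: exp_minus field_simps)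
qed

text \<open>
  The set \<open>A\<close> restricts the spectrum. A multiplier that is admissible for the sup norm on the
  imaginary axis is admissible for every translation invariant norm, by duality.
\<close>

definition dirichlet_multiplier :: "nat set \<Rightarrow> (nat \<Rightarrow> complex) \<Rightarrow> real \<Rightarrow> bool" where
  "dirichlet_multiplier A m C \<longleftrightarrow>
     (\<forall>S c B. finite S \<and> S \<subseteq> A \<and> (\<forall>\<tau>::real. cmod (\<Sum>n\<in>S. c n * cis (- \<tau> * ln (real n))) \<le> B)
        \<longrightarrow> cmod (\<Sum>n\<in>S. m n * c n) \<le> C * B)"

section \<open>Shifts, powers of the logarithm and Gaussians as multipliers\<close>

lemma dirichlet_multiplierI:
  assumes "\<And>S c B. finite S \<Longrightarrow> S \<subseteq> A \<Longrightarrow>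
    (\<And>\<tau>. cmod (\<Sum>n\<in>S. c n * cis (- \<tau> * ln (real n))) \<le> B) \<Longrightarrow> cmod (\<Sum>n\<in>S. m n * c n) \<le> C * B"
  shows "dirichlet_multiplier A m C"
  using assms unfolding dirichlet_multiplier_def by blast

text \<open>The multiplied sum is the exponential sum evaluated at the point \<sigma> of the
  half-plane, and the lowest frequency \<open>ln N\<close> gives the decay. For N = 1 this is the
  contractivity of shifts.\<close>

lemma dirichlet_multiplier_shift:
  assumes "N \<ge> 1" "\<sigma> \<ge> 0"
  shows "dirichlet_multiplier {N..} (\<lambda>n. of_real (real n powr - \<sigma>)) (real N powr - \<sigma>)"
proof (rule dirichlet_multiplierI)
  fix S c B assume *: "finite S" "S \<subseteq> {N..}" "\<And>\<tau>. cmod (\<Sum>n\<in>S. c n * cis (- \<tau> * ln (real n))) \<le> B"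
  have n: "n \<ge> N" if "n \<in> S" for n using *(2) that by auto
  have "cmod (\<Sum>n\<in>S. c n * exp (- of_real \<sigma> * of_real (ln (real n)))) \<le> B * exp (- ln (real N) * Re (of_real \<sigma>))"
  proof (rule exponential_sum_half_plane[OF *(1) _ *(3)])
    show "ln (real N) \<le> ln (real n)" if "n \<in> S" for n using n[OF that] assms by simp
  qed (use assms in auto)
  also have "(\<Sum>n\<in>S. c n * exp (- of_real \<sigma> * of_real (ln (real n)))) = (\<Sum>n\<in>S. of_real (real n powr - \<sigma>) * c n)"
  proof (rule sum.cong)
    fix x assume "x \<in> S" hence "x \<noteq> 0" using n[of x] assms by auto
    thus "c x * exp (- of_real \<sigma> * of_real (ln (real x))) = of_real (real x powr - \<sigma>) * c x"
      by (simp add: powr_def flip: exp_of_real)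
  qed simp
  finally show "cmod (\<Sum>n\<in>S. of_real (real n powr - \<sigma>) * c n) \<le> real N powr - \<sigma> * B"
    using assms by (simp add: powr_def mult.commute)
qed

text \<open>Growth to the left of the axis is governed by the highest frequency: after reflection
  the frequencies \<open>- ln n\<close> are bounded below by \<open>- ln N\<close>.\<close>

lemma dirichlet_multiplier_inverse_shift:
  assumes "N \<ge> 1" "\<sigma> \<ge> 0"
  shows "dirichlet_multiplier {1..N} (\<lambda>n. of_real (real n powr \<sigma>)) (real N powr \<sigma>)"
proof (rule dirichlet_multiplierI)
  fix S c B assume *: "finite S" "S \<subseteq> {1..N}" "\<And>\<tau>. cmod (\<Sum>n\<in>S. c n * cis (- \<tau> * ln (real n))) \<le> B"
  have n: "n \<ge> 1" "n \<le> N" if "n \<in> S" for n using *(2) that by auto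
  have B0: "B \<ge> 0" using *(3)[of 0] norm_ge_zero order_trans by blast
  have "cmod (\<Sum>n\<in>S. c n * exp (- of_real \<sigma> * of_real (- ln (real n)))) \<le> B * exp (- (- ln (real N)) * Re (of_real \<sigma>))"
  proof (rule exponential_sum_half_plane[OF *(1)])
    show "- ln (real N) \<le> - ln (real n)" if "n \<in> S" for n using n[OF that] assms by simp
    show "cmod (\<Sum>n\<in>S. c n * cis (- \<tau> * - ln (real n))) \<le> B" for \<tau>
      using *(3)[of "-\<tau>"] by simp
  qed (use assms in auto)
  also have "(\<Sum>n\<in>S. c n * exp (- of_real \<sigma> * of_real (- ln (real n)))) = (\<Sum>n\<in>S. of_real (real n powr \<sigma>) * c n)"
  proof (rule sum.cong)
    fix x assume "x \<in> S" hence "x \<noteq> 0" using n[of x] assms by auto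
    thus "c x * exp (- of_real \<sigma> * of_real (- ln (real x))) = of_real (real x powr \<sigma>) * c x"
      by (simp add: powr_def flip: exp_of_real)
  qed simp
  also have "B * exp (- (- ln (real N)) * Re (of_real \<sigma>)) \<le> real N powr \<sigma> * B"
    using assms by (simp add: powr_def mult.commute)
  finally show "cmod (\<Sum>n\<in>S. of_real (real n powr \<sigma>) * c n) \<le> real N powr \<sigma> * B" .
qed

text \<open>
  Bernstein's inequality: Cauchy's estimate on a circle of radius \<open>1 / ln N\<close>, on which the
  exponential sum grows at most by a factor \<open>exp 1\<close>.
\<close>

lemma dirichlet_multiplier_ln:
  assumes "N \<ge> 2"
  shows "dirichlet_multiplier {1..N} (\<lambda>n. of_real (ln (real n))) (exp 1 * ln (real N))"
proof (rule dirichlet_multiplierI)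
  fix S c B assume *: "finite S" "S \<subseteq> {1..N}" "\<And>\<tau>. cmod (\<Sum>n\<in>S. c n * cis (- \<tau> * ln (real n))) \<le> B"
  have n: "n \<ge> 1" "n \<le> N" if "n \<in> S" for n using *(2) that by auto
  have B0: "B \<ge> 0" using *(3)[of 0] norm_ge_zero order_trans by blast
  have lnN: "ln (real N) > 0" using assms by simp
  define h where "h = (\<lambda>s. \<Sum>n\<in>S. c n * exp (- s * of_real (ln (real n))))"
  define r where "r = 1 / ln (real N)"
  have r: "r > 0" using lnN by (simp add: r_def)
  have h_bound: "cmod (h s) \<le> exp 1 * B" if "cmod s = r" for s
  proof -
    have Re: "\<bar>Re s\<bar> * ln (real N) \<le> 1"
      using abs_Re_le_cmod[of s] that lnN by (simp add: r_def field_simps)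
    show ?thesis
    proof (cases "Re s \<ge> 0")
      case True
      have "cmod (h s) \<le> B * exp (- 0 * Re s)"
        unfolding h_def by (rule exponential_sum_half_plane[OF *(1) _ *(3) True]) (use n in auto)
      also have "\<dots> \<le> exp 1 * B" using B0 by (simp add: mult_le_cancel_right1)
      finally show ?thesis .
    next
      case False
      \<comment> \<open>To the left of the axis both the point and the frequencies are reflected, so
        that the half-plane estimate applies with lowest frequency \<open>- ln N\<close>.\<close>
      have "cmod (\<Sum>n\<in>S. c n * exp (- (- s) * of_real (- ln (real n)))) \<le> B * exp (- (- ln (real N)) * Re (- s))"
      proof (rule exponential_sum_half_plane[OF *(1)])
        show "- ln (real N) \<le> - ln (real n)" if "n \<in> S" for n using n[OF that] by simp
        show "cmod (\<Sum>n\<in>S. c n * cis (- \<tau> * - ln (real n))) \<le> B" for \<tau>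
          using *(3)[of "-\<tau>"] by simp
      qed (use False in auto)
      also have "exp (- (- ln (real N)) * Re (- s)) \<le> exp 1"
        using Re False by (simp add: mult.commute)
      finally show ?thesis using B0 by (simp add: h_def mult.commute[of B] mult_right_mono)
    qed
  qed
  have "cmod ((deriv ^^ 1) h 0) \<le> fact 1 * (exp 1 * B) / r ^ 1"
  proof (rule Cauchy_inequality)
    show "h holomorphic_on ball 0 r" unfolding h_def by (intro holomorphic_intros)
    show "continuous_on (cball 0 r) h" unfolding h_def by (intro continuous_intros)
  qed (use r h_bound in auto)
  moreover have "(h has_field_derivative (\<Sum>n\<in>S. c n * (- of_real (ln (real n))))) (at 0)"
    unfolding h_def by (auto intro!: derivative_eq_intros sum.cong)
  hence "deriv h 0 = (\<Sum>n\<in>S. c n * (- of_real (ln (real n))))" by (rule DERIV_imp_deriv)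
  moreover have "\<dots> = - (\<Sum>n\<in>S. of_real (ln (real n)) * c n)"
    unfolding sum_negf[symmetric] by (rule sum.cong) auto
  ultimately show "cmod (\<Sum>n\<in>S. of_real (ln (real n)) * c n) \<le> exp 1 * ln (real N) * B"
    by (simp add: r_def mult_ac)
qed

text \<open>\<open>ln n powr - t\<close> is the average of n^(-x) against the Gamma density in x. On
  spectrum {2..} each n^(-x) is a multiplier with constant 2^(-x), and these constants average to
  \<open>ln 2 powr - t\<close>. The spectral gap makes the average converge at infinity.\<close>

lemma dirichlet_multiplier_fractional_integral:
  assumes t: "t > 0"
  shows "dirichlet_multiplier {2..} (\<lambda>n. of_real (ln (real n) powr - t)) (ln 2 powr - t)"
proof (rule dirichlet_multiplierI)
  fix S c B assume *: "finite S" "S \<subseteq> {2..}" "\<And>\<tau>. cmod (\<Sum>n\<in>S. c n * cis (- \<tau> * ln (real n))) \<le> B"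
  have n: "n \<ge> 2" if "n \<in> S" for n using *(2) that by auto
  define k :: "real \<Rightarrow> real \<Rightarrow> real" where "k = (\<lambda>c x. indicator {0<..} x * (x powr (t - 1) * exp (- c * x)))"
  have k: "has_bochner_integral lborel (k c) (Gamma t / c powr t)" if "c > 0" for c
    unfolding k_def using has_bochner_integral_powr_exp[OF that t] .
  define F where "F = (\<lambda>x. \<Sum>n\<in>S. complex_of_real (k (ln (real n)) x) * c n)"
  have F: "has_bochner_integral lborel F (\<Sum>n\<in>S. complex_of_real (Gamma t / ln (real n) powr t) * c n)"
    unfolding F_def
    by (intro has_bochner_integral_sum has_bochner_integral_mult_left has_bochner_integral_of_real k)
       (use n in force)
  have F_bound: "cmod (F x) \<le> B * k (ln 2) x" for x
  proof (cases "x > 0")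
    case True
    have "cmod (\<Sum>n\<in>S. c n * exp (- of_real x * of_real (ln (real n)))) \<le> B * exp (- ln 2 * Re (of_real x))"
      by (rule exponential_sum_half_plane[OF *(1) _ *(3)]) (use n True in force)+
    hence "x powr (t - 1) * cmod (\<Sum>n\<in>S. c n * exp (- of_real x * of_real (ln (real n)))) \<le> x powr (t - 1) * (B * exp (- ln 2 * x))"
      by (intro mult_left_mono) auto
    moreover have "F x = of_real (x powr (t - 1)) * (\<Sum>n\<in>S. c n * exp (- of_real x * of_real (ln (real n))))"
      using True unfolding F_def k_def sum_distrib_left
      by (intro sum.cong refl) (simp add: mult_ac flip: exp_of_real)
    ultimately show ?thesis using True by (simp add: norm_mult k_def mult_ac)
  qed (simp add: F_def k_def)
  have G: "Gamma t > 0" using t by (rule Gamma_real_pos)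
  have "cmod (\<Sum>n\<in>S. complex_of_real (Gamma t / ln (real n) powr t) * c n) = cmod (integral\<^sup>L lborel F)"
    using has_bochner_integral_integral_eq[OF F] by simp
  also have "\<dots> \<le> (\<integral>x. B * k (ln 2) x \<partial>lborel)"
    by (rule order_trans[OF integral_norm_bound integral_mono])
       (use F k[of "ln 2"] F_bound in \<open>auto simp: has_bochner_integral_iff\<close>)
  also have "\<dots> = B * (Gamma t / ln 2 powr t)"
    using has_bochner_integral_integral_eq[OF k[of "ln 2"]] by simp
  finally have "cmod (\<Sum>n\<in>S. complex_of_real (Gamma t / ln (real n) powr t) * c n) \<le> B * (Gamma t / ln 2 powr t)" .
  also have "(\<Sum>n\<in>S. complex_of_real (Gamma t / ln (real n) powr t) * c n) =
      of_real (Gamma t) * (\<Sum>n\<in>S. of_real (ln (real n) powr - t) * c n)"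
    by (simp add: sum_distrib_left powr_minus divide_inverse mult_ac)
  finally show "cmod (\<Sum>n\<in>S. of_real (ln (real n) powr - t) * c n) \<le> ln 2 powr - t * B"
    using G by (simp add: norm_mult powr_minus field_simps)
qed

text \<open>The Gaussian is the characteristic function of the normal distribution at \<delta> * (ln
  n - v), so the multiplied sum is a probability average of vertical translates with unimodular
  factors. This works on every spectrum. Centre 0 serves the completions, centre \<open>ln k\<close>
  isolates a coefficient.\<close>

lemma dirichlet_multiplier_gaussian:
  "dirichlet_multiplier A (\<lambda>n. of_real (exp (- (\<delta> * (ln (real n) - v))\<^sup>2 / 2))) 1"
proof (rule dirichlet_multiplierI)
  fix S c B assume *: "finite S" "\<And>\<tau>. cmod (\<Sum>n\<in>S. c n * cis (- \<tau> * ln (real n))) \<le> B"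
  interpret N: real_distribution std_normal_distribution by (rule real_dist_normal_dist)
  have char: "(\<integral>x. cis (t * x) \<partial>std_normal_distribution) = of_real (exp (- t\<^sup>2 / 2))" for t :: real
    using fun_cong[OF char_std_normal_distribution, of t] by (simp add: char_def cis_conv_exp)
  have int: "integrable std_normal_distribution (\<lambda>x. cis (t * x))" for t
    by (rule N.integrable_const_bound[where B = 1]) (auto simp: cis_conv_exp)
  have "(\<Sum>n\<in>S. of_real (exp (- (\<delta> * (ln (real n) - v))\<^sup>2 / 2)) * c n)
        = (\<integral>x. (\<Sum>n\<in>S. cis (\<delta> * (ln (real n) - v) * x) * c n) \<partial>std_normal_distribution)"
    using int by (subst Bochner_Integration.integral_sum) (auto simp: char)
  also have "cmod \<dots> \<le> (\<integral>x. B \<partial>std_normal_distribution)"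
  proof (rule order_trans[OF integral_norm_bound integral_mono])
    fix x
    have "(\<Sum>n\<in>S. cis (\<delta> * (ln (real n) - v) * x) * c n) = cis (- \<delta> * v * x) * (\<Sum>n\<in>S. c n * cis (- (- \<delta> * x) * ln (real n)))"
      unfolding sum_distrib_left by (intro sum.cong refl) (simp add: cis_mult algebra_simps)
    thus "cmod (\<Sum>n\<in>S. cis (\<delta> * (ln (real n) - v) * x) * c n) \<le> B"
      using *(2)[of "- \<delta> * x"] by (simp add: norm_mult)
  qed (use int in auto)
  finally show "cmod (\<Sum>n\<in>S. of_real (exp (- (\<delta> * (ln (real n) - v))\<^sup>2 / 2)) * c n) \<le> 1 * B"
    using N.prob_space by simp
qed

text \<open>Gaussians centred at \<open>ln k\<close> and narrowing with j converge to the indicator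
  of n = k, and the constant 1 passes to the limit.\<close>

lemma dirichlet_multiplier_coefficient:
  assumes "k \<ge> 1"
  shows "dirichlet_multiplier {1..} (\<lambda>n. if n = k then 1 else 0) 1"
proof (rule dirichlet_multiplierI)
  fix S c B assume *: "finite S" "S \<subseteq> {1..}" "\<And>\<tau>. cmod (\<Sum>n\<in>S. c n * cis (- \<tau> * ln (real n))) \<le> B"
  have lim: "(\<lambda>j. cmod (\<Sum>n\<in>S. of_real (exp (- (real j * (ln (real n) - ln (real k)))\<^sup>2 / 2)) * c n))
     \<longlonglongrightarrow> cmod (\<Sum>n\<in>S. of_real (if n = k then 1 else 0) * c n)"
  proof (intro tendsto_intros)
    fix n assume "n \<in> S"
    show "(\<lambda>j. exp (- (real j * (ln (real n) - ln (real k)))\<^sup>2 / 2)) \<longlonglongrightarrow> (if n = k then 1 else 0)"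
    proof (cases "n = k")
      case False
      with assms *(2) \<open>n \<in> S\<close> have "ln (real n) - ln (real k) \<noteq> 0" by auto
      hence "(ln (real n) - ln (real k))\<^sup>2 > 0" by simp
      thus ?thesis using False by (simp add: power_mult_distrib) real_asymp
    qed simp
  qed
  have "cmod (\<Sum>n\<in>S. of_real (exp (- (\<delta> * (ln (real n) - v))\<^sup>2 / 2)) * c n) \<le> 1 * B" for \<delta> v
    using dirichlet_multiplier_gaussian[of S \<delta> v] *(1,3) unfolding dirichlet_multiplier_def by blast
  hence "cmod (\<Sum>n\<in>S. of_real (if n = k then 1 else 0) * c n) \<le> 1 * B"
    by (intro LIMSEQ_le_const2[OF lim]) blast
  also have "(\<Sum>n\<in>S. of_real (if n = k then 1 else 0) * c n) = (\<Sum>n\<in>S. (if n = k then 1 else 0) * c n)"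
    by (intro sum.cong) auto
  finally show "cmod (\<Sum>n\<in>S. (if n = k then 1 else 0) * c n) \<le> 1 * B" .
qed

section \<open>A lower bound for the number of primes\<close>

text \<open>
  Every \<open>n \<le> x\<close> is the product of a squarefree number, which is a product of distinct primes
  \<open>p \<le> x\<close>, and a square \<open>m\<^sup>2\<close> with \<open>m \<le> sqrt x\<close>.
\<close>

lemma prime_counting_lower_bound:
  "m \<le> card {p. prime p \<and> p \<le> (4::nat) ^ m}"
proof -
  define x :: nat where "x = 4 ^ m"
  define A where "A = {p. prime p \<and> p \<le> x}"
  have finA: "finite A" unfolding A_def by (rule finite_subset[of _ "{..x}"]) auto
  have "{1..x} \<subseteq> (\<lambda>(B, k). \<Prod>B * k\<^sup>2) ` (Pow A \<times> {1..2 ^ m})"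
  proof
    fix n assume n: "n \<in> {1..x}"
    define s where "s = squarefree_part n"
    define k where "k = square_part n"
    have nsk: "n = s * k\<^sup>2" unfolding s_def k_def by (rule squarefree_decompose)
    have n0: "n \<noteq> 0" using n by auto
    have k0: "k \<noteq> 0" and s0: "s \<noteq> 0" using nsk n0 by auto
    have "k\<^sup>2 \<le> n" using nsk s0 by (cases s) auto
    also have "n \<le> 4 ^ m" using n by (simp add: x_def)
    also have "(4::nat) ^ m = (2 ^ m)\<^sup>2" using power_mult[of "2::nat" 2 m] power_mult[of "2::nat" m 2]
      by (simp add: mult.commute)
    finally have "k\<^sup>2 \<le> (2 ^ m)\<^sup>2" .
    hence k: "k \<in> {1..2 ^ m}" using k0 by (auto simp: power2_nat_le_eq_le)
    have sq: "squarefree s" by (simp add: s_def)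
    have "s = (\<Prod>p\<in>prime_factors s. p ^ multiplicity p s)"
      using s0 by (simp add: prod_prime_factors)
    also have "\<dots> = \<Prod>(prime_factors s)"
    proof (rule prod.cong)
      fix p assume p: "p \<in> prime_factors s"
      hence "multiplicity p s \<le> 1"
        unfolding s_def using prime_multiplicity_squarefree_part_le_Suc_0[of p n] by auto
      moreover have "multiplicity p s > 0" using p by (simp add: prime_factors_multiplicity)
      ultimately have "multiplicity p s = 1" by linarith
      thus "p ^ multiplicity p s = p" by simp
    qed simp
    finally have "s = \<Prod>(prime_factors s)" .
    moreover have "prime_factors s \<subseteq> A"
    proof
      fix p assume p: "p \<in> prime_factors s"
      hence "p dvd n" using nsk by (auto simp: in_prime_factors_iff)
      hence "p \<le> n" using n0 by (intro dvd_imp_le) auto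
      thus "p \<in> A" using p n by (auto simp: A_def in_prime_factors_iff)
    qed
    ultimately show "n \<in> (\<lambda>(B, k). \<Prod>B * k\<^sup>2) ` (Pow A \<times> {1..2 ^ m})"
      using k nsk by (intro image_eqI[of _ _ "(prime_factors s, k)"]) auto
  qed
  hence "card {1..x} \<le> card (Pow A \<times> {1..(2::nat) ^ m})"
    using finA by (intro surj_card_le) auto
  \<comment> \<open>There are 2^|A| squarefree parts and at most sqrt x square parts. The base 4
    makes sqrt x = 2^m an integer.\<close>
  hence "4 ^ m \<le> 2 ^ card A * (2 ^ m :: nat)"
    using finA by (simp add: x_def card_cartesian_product card_Pow)
  moreover have "(4::nat) ^ m = 2 ^ m * 2 ^ m" by (simp flip: power_mult_distrib)
  ultimately have "(2::nat) ^ m \<le> 2 ^ card A" by simp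
  thus ?thesis by (simp add: A_def x_def)
qed

section \<open>Haar measure on the infinite torus\<close>

lemma sets_circle_measure [measurable_cong]:
  "sets circle_measure = sets (restrict_space borel (sphere 0 1))"
  by (simp add: circle_measure_def)

lemma space_circle_measure: "space circle_measure = sphere 0 1"
  by (simp add: circle_measure_def space_restrict_space)

lemma measurable_cis_sphere [measurable]:
  "cis \<in> measurable lborel (restrict_space borel (sphere 0 1))"
  by (rule measurable_restrict_space2) (auto intro!: borel_measurable_continuous_onI continuous_intros)

lemma nn_integral_circle_measure:
  assumes [measurable]: "f \<in> borel_measurable (restrict_space borel (sphere 0 1))"
  shows "(\<integral>\<^sup>+z. f z \<partial>circle_measure) =
    (\<integral>\<^sup>+x. f (cis x) * indicator {0..<2 * pi} x \<partial>lborel) / ennreal (2 * pi)"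
proof -
  have "(\<lambda>x. f (cis x)) \<in> borel_measurable lborel" by measurable
  thus ?thesis
    unfolding circle_measure_def by (subst nn_integral_distr) (auto simp: nn_integral_uniform_measure)
qed

interpretation circle: prob_space circle_measure
proof
  have "emeasure circle_measure (space circle_measure) = (\<integral>\<^sup>+z. 1 \<partial>circle_measure)" by simp
  also have "\<dots> = 1"
    by (subst nn_integral_circle_measure) (auto simp: divide_ennreal)
  finally show "emeasure circle_measure (space circle_measure) = 1" .
qed

text \<open>The piece of the translated interval beyond 2 pi is moved back by one period and fills
  the gap [0, a).\<close>

lemma nn_integral_periodic_shift:
  fixes g :: "real \<Rightarrow> ennreal"
  assumes [measurable]: "g \<in> borel_measurable borel"
    and per: "\<And>x. g (x + 2 * pi) = g x" and a: "0 \<le> a" "a < 2 * pi"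
  shows "(\<integral>\<^sup>+x. g (x + a) * indicator {0..<2 * pi} x \<partial>lborel) = (\<integral>\<^sup>+x. g x * indicator {0..<2 * pi} x \<partial>lborel)"
proof -
  have shift: "(\<integral>\<^sup>+x. f (x + b) \<partial>lborel) = (\<integral>\<^sup>+x. f x \<partial>lborel)"
    if [measurable]: "f \<in> borel_measurable borel" for f :: "real \<Rightarrow> ennreal" and b
    using nn_integral_real_affine[of f 1 b] by (simp add: add.commute)
  have "(\<integral>\<^sup>+x. g (x + a) * indicator {0..<2 * pi} x \<partial>lborel) =
        (\<integral>\<^sup>+x. g (x + a) * indicator {a..<2 * pi + a} (x + a) \<partial>lborel)"
    by (intro nn_integral_cong) (auto simp: indicator_def)
  also have "\<dots> = (\<integral>\<^sup>+x. g x * indicator {a..<2 * pi + a} x \<partial>lborel)"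
    by (rule shift) measurable
  also have "\<dots> = (\<integral>\<^sup>+x. g x * indicator {a..<2 * pi} x + g x * indicator {2 * pi..<2 * pi + a} x \<partial>lborel)"
    using a by (intro nn_integral_cong) (auto simp: indicator_def)
  also have "\<dots> = (\<integral>\<^sup>+x. g x * indicator {a..<2 * pi} x \<partial>lborel) + (\<integral>\<^sup>+x. g x * indicator {2 * pi..<2 * pi + a} x \<partial>lborel)"
    by (rule nn_integral_add) measurable
  also have "(\<integral>\<^sup>+x. g x * indicator {2 * pi..<2 * pi + a} x \<partial>lborel) =
     (\<integral>\<^sup>+x. g (x + 2 * pi) * indicator {2 * pi..<2 * pi + a} (x + 2 * pi) \<partial>lborel)"
    by (rule shift[symmetric]) measurable
  also have "\<dots> = (\<integral>\<^sup>+x. g x * indicator {0..<a} x \<partial>lborel)"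
    by (intro nn_integral_cong) (auto simp: indicator_def per)
  also have "(\<integral>\<^sup>+x. g x * indicator {a..<2 * pi} x \<partial>lborel) + \<dots> =
      (\<integral>\<^sup>+x. g x * indicator {a..<2 * pi} x + g x * indicator {0..<a} x \<partial>lborel)"
    by (rule nn_integral_add[symmetric]) measurable
  also have "\<dots> = (\<integral>\<^sup>+x. g x * indicator {0..<2 * pi} x \<partial>lborel)"
    using a by (intro nn_integral_cong) (auto simp: indicator_def)
  finally show ?thesis .
qed

lemma measurable_circle_rotation:
  assumes "cmod w = 1"
  shows "(\<lambda>z. w * z) \<in> measurable circle_measure circle_measure"
  unfolding measurable_cong_sets[OF sets_circle_measure sets_circle_measure]
  by (rule measurable_restrict_space2)
     (auto simp: space_restrict_space norm_mult assms intro!: measurable_restrict_space1)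

text \<open>In the angular coordinate the rotation is a translation modulo 2 pi; the argument of w
  is taken in [0, 2 pi) for this.\<close>

lemma emeasure_circle_rotation:
  assumes w: "cmod w = 1" and A: "A \<in> sets circle_measure"
  shows "emeasure circle_measure ((\<lambda>z. w * z) -` A \<inter> space circle_measure) = emeasure circle_measure A"
proof -
  obtain a where a: "w = cis a" "0 \<le> a" "a < 2 * pi"
    using w Arg2pi_eq[of w] Arg2pi_ge_0[of w] Arg2pi_lt_2pi[of w]
    by (metis cis_conv_exp mult_1 of_real_1)
  have [measurable]: "A \<in> sets (restrict_space borel (sphere 0 1))" using A sets_circle_measure by simp
  have B: "(\<lambda>z. w * z) -` A \<inter> space circle_measure \<in> sets circle_measure"
    using measurable_circle_rotation[OF w] A by (rule measurable_sets)
  hence [measurable]: "(\<lambda>z. w * z) -` A \<inter> space circle_measure \<in> sets (restrict_space borel (sphere 0 1))"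
    using sets_circle_measure by simp
  have "emeasure circle_measure ((\<lambda>z. w * z) -` A \<inter> space circle_measure)
      = (\<integral>\<^sup>+z. indicator ((\<lambda>z. w * z) -` A \<inter> space circle_measure) z \<partial>circle_measure)"
    using B by simp
  also have "\<dots> = (\<integral>\<^sup>+x. indicator A (cis (x + a)) * indicator {0..<2 * pi} x \<partial>lborel) / ennreal (2 * pi)"
    by (subst nn_integral_circle_measure, measurable)
       (auto intro!: arg_cong2[where f = "(/)"] nn_integral_cong
          simp: indicator_def space_circle_measure a cis_mult add.commute)
  also have "(\<integral>\<^sup>+x. indicator A (cis (x + a)) * indicator {0..<2 * pi} x \<partial>lborel) =
     (\<integral>\<^sup>+x. indicator A (cis x) * indicator {0..<2 * pi} x \<partial>lborel)"
  proof (rule nn_integral_periodic_shift)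
    have "(\<lambda>x. indicator A (cis x) :: ennreal) \<in> borel_measurable lborel" by measurable
    thus "(\<lambda>x. indicator A (cis x) :: ennreal) \<in> borel_measurable borel" by simp
  qed (use a in \<open>auto simp: cis_mult[symmetric]\<close>)
  also have "\<dots> / ennreal (2 * pi) = (\<integral>\<^sup>+z. indicator A z \<partial>circle_measure)"
    by (subst nn_integral_circle_measure) auto
  also have "\<dots> = emeasure circle_measure A" using A by simp
  finally show ?thesis .
qed

section \<open>Rotation invariance and independence on the infinite torus\<close>

interpretation torus: product_prob_space "\<lambda>_. circle_measure" "{p::nat. prime p}"
  rewrites "Pi\<^sub>M {p. prime p} (\<lambda>_. circle_measure) = torus_measure"
  by unfold_locales (simp add: torus_measure_def)

lemma space_torus_measure:
  "space torus_measure = (\<Pi>\<^sub>E p\<in>{p. prime p}. sphere 0 1)"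
  by (simp add: torus_measure_def space_PiM space_circle_measure)

text \<open>Translation by the group element w. The restriction to primes is needed because points
  of the product space are \<open>undefined\<close> at all other indices.\<close>

definition torus_rotation :: "(nat \<Rightarrow> complex) \<Rightarrow> (nat \<Rightarrow> complex) \<Rightarrow> nat \<Rightarrow> complex" where
  "torus_rotation w z = (\<lambda>p\<in>{p. prime p}. w p * z p)"

lemma measurable_torus_rotation:
  assumes "\<And>p. prime p \<Longrightarrow> cmod (w p) = 1"
  shows "torus_rotation w \<in> measurable torus_measure torus_measure"
  unfolding torus_measure_def torus_rotation_def
proof (rule measurable_restrict)
  fix p :: nat assume "p \<in> {p. prime p}"
  moreover from this have "(\<lambda>z. w p * z) \<in> measurable circle_measure circle_measure"
    by (intro measurable_circle_rotation assms) auto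
  ultimately show "(\<lambda>z. w p * z p) \<in> measurable (\<Pi>\<^sub>M p\<in>{p. prime p}. circle_measure) circle_measure"
    by (rule measurable_compose[OF measurable_component_singleton])
qed

text \<open>A product measure is determined by its values on cylinders over finitely many
  coordinates. The preimage of a cylinder is a cylinder with rotated sides, so invariance reduces to
  one circle at a time.\<close>

lemma distr_torus_rotation:
  assumes w: "\<And>p. prime p \<Longrightarrow> cmod (w p) = 1"
  shows "distr torus_measure torus_measure (torus_rotation w) = torus_measure"
proof (rule torus.PiM_eq[unfolded torus_measure_def[symmetric]])
  note [measurable] = measurable_torus_rotation[OF w]
  show "sets (distr torus_measure torus_measure (torus_rotation w)) = sets torus_measure" by simp
  fix J F assume J: "finite J" "J \<subseteq> {p::nat. prime p}" "\<And>j. j \<in> J \<Longrightarrow> F j \<in> sets circle_measure"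
  let ?emb = "prod_emb {p. prime p} (\<lambda>_. circle_measure) J"
  let ?G = "\<lambda>j. (\<lambda>z. w j * z) -` F j \<inter> space circle_measure"
  have G: "?G j \<in> sets circle_measure" if "j \<in> J" for j
    using measurable_sets[OF measurable_circle_rotation J(3)[OF that]] w J(2) that by blast
  have "?emb (\<Pi>\<^sub>E j\<in>J. F j) \<in> sets torus_measure"
    unfolding torus_measure_def using J by (intro sets_PiM_I) auto
  hence "emeasure (distr torus_measure torus_measure (torus_rotation w)) (?emb (\<Pi>\<^sub>E j\<in>J. F j)) =
      emeasure torus_measure (torus_rotation w -` ?emb (\<Pi>\<^sub>E j\<in>J. F j) \<inter> space torus_measure)"
    by (subst emeasure_distr) auto
  also have "torus_rotation w -` ?emb (\<Pi>\<^sub>E j\<in>J. F j) \<inter> space torus_measure = ?emb (\<Pi>\<^sub>E j\<in>J. ?G j)"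
    using J(2) w by (auto simp: prod_emb_def space_torus_measure space_circle_measure torus_rotation_def
        PiE_iff subset_iff norm_mult)
  also have "emeasure torus_measure (?emb (\<Pi>\<^sub>E j\<in>J. ?G j)) = (\<Prod>j\<in>J. emeasure circle_measure (?G j))"
    using J G by (intro torus.emeasure_PiM_emb[unfolded torus_measure_def[symmetric]]) auto
  also have "\<dots> = (\<Prod>j\<in>J. emeasure circle_measure (F j))"
    using J(2) by (intro prod.cong refl emeasure_circle_rotation w J(3)) auto
  finally show "emeasure (distr torus_measure torus_measure (torus_rotation w)) (?emb (\<Pi>\<^sub>E j\<in>J. F j))
      = (\<Prod>j\<in>J. emeasure circle_measure (F j))" .
qed

lemma integral_torus_rotation:
  fixes f :: "(nat \<Rightarrow> complex) \<Rightarrow> real"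
  assumes w: "\<And>p. prime p \<Longrightarrow> cmod (w p) = 1" and f: "f \<in> borel_measurable torus_measure"
  shows "(\<integral>z. f (torus_rotation w z) \<partial>torus_measure) = (\<integral>z. f z \<partial>torus_measure)"
proof -
  have "(\<integral>z. f z \<partial>torus_measure) = (\<integral>z. f z \<partial>distr torus_measure torus_measure (torus_rotation w))"
    by (simp add: distr_torus_rotation[OF w])
  also have "\<dots> = (\<integral>z. f (torus_rotation w z) \<partial>torus_measure)"
    by (rule integral_distr[OF measurable_torus_rotation[OF w] f])
  finally show ?thesis ..
qed

text \<open>Independence of the coordinates: the integrand depends on finitely many of them, so the
  integral is one over a finite product.\<close>

lemma integral_torus_prod:
  fixes g :: "complex \<Rightarrow> real"
  assumes S: "finite S" "S \<subseteq> {p. prime p}" and g: "integrable circle_measure g"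
  shows "(\<integral>z. (\<Prod>p\<in>S. g (z p)) \<partial>torus_measure) = (\<integral>z. g z \<partial>circle_measure) ^ card S"
proof -
  have ps: "product_sigma_finite (\<lambda>_::nat. circle_measure)" by unfold_locales
  have [measurable]: "g \<in> borel_measurable circle_measure" using g by simp
  have restr: "(\<lambda>z. restrict z S) \<in> measurable torus_measure (Pi\<^sub>M S (\<lambda>_. circle_measure))"
    unfolding torus_measure_def using S(2) by (rule measurable_restrict_subset)
  have "(\<integral>z. (\<Prod>p\<in>S. g (z p)) \<partial>torus_measure) = (\<integral>z. (\<Prod>p\<in>S. g (restrict z S p)) \<partial>torus_measure)"
    by (simp cong: prod.cong)
  also have "\<dots> = (\<integral>y. (\<Prod>p\<in>S. g (y p)) \<partial>distr torus_measure (Pi\<^sub>M S (\<lambda>_. circle_measure)) (\<lambda>z. restrict z S))"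
    by (rule integral_distr[OF restr, symmetric]) measurable
  also have "distr torus_measure (Pi\<^sub>M S (\<lambda>_. circle_measure)) (\<lambda>z. restrict z S) = Pi\<^sub>M S (\<lambda>_. circle_measure)"
    using torus.distr_PiM_restrict_finite[OF S] by (simp add: torus_measure_def)
  also have "(\<integral>y. (\<Prod>p\<in>S. g (y p)) \<partial>Pi\<^sub>M S (\<lambda>_. circle_measure)) = (\<Prod>p\<in>S. \<integral>z. g z \<partial>circle_measure)"
    by (rule product_sigma_finite.product_integral_prod[OF ps]) (use S g in auto)
  finally show ?thesis by simp
qed

section \<open>Characters of the torus\<close>

lemma measurable_torus_component:
  assumes "prime p"
  shows "(\<lambda>z. z p) \<in> borel_measurable torus_measure"
proof -
  have "(\<lambda>z::nat \<Rightarrow> complex. z p) \<in> measurable torus_measure circle_measure"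
    unfolding torus_measure_def using assms by (intro measurable_component_singleton) auto
  moreover have "(\<lambda>z. z) \<in> measurable circle_measure borel"
    unfolding measurable_cong_sets[OF sets_circle_measure refl] by (rule measurable_restrict_space1) simp
  ultimately show ?thesis by (rule measurable_compose)
qed

lemma measurable_torus_char [measurable]: "(\<lambda>z. torus_char z n) \<in> borel_measurable torus_measure"
  unfolding torus_char_def by (intro borel_measurable_prod borel_measurable_power measurable_torus_component) auto

lemma norm_torus_component: "z \<in> space torus_measure \<Longrightarrow> prime p \<Longrightarrow> cmod (z p) = 1"
  by (auto simp: space_torus_measure PiE_iff)

lemma norm_torus_char: "z \<in> space torus_measure \<Longrightarrow> cmod (torus_char z n) = 1"
  unfolding torus_char_def prod_norm[symmetric]
  by (intro prod.neutral ballI)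
     (auto simp: norm_power norm_torus_component dest: in_prime_factors_imp_prime)

lemma torus_char_rotation:
  "torus_char (torus_rotation w z) n = torus_char w n * torus_char z n"
  unfolding torus_char_def torus_rotation_def prod.distrib[symmetric]
  by (intro prod.cong refl) (auto simp: power_mult_distrib)

lemma torus_char_mult:
  assumes "m > 0" "n > 0"
  shows "torus_char z (m * n) = torus_char z m * torus_char z n"
proof -
  \<comment> \<open>All three characters are written as products over the primes of m * n; the added
    factors have exponent 0.\<close>
  have eq: "torus_char z k = (\<Prod>p\<in>prime_factors (m * n). z p ^ multiplicity p k)" if "k dvd m * n" for k
    unfolding torus_char_def
  proof (rule prod.mono_neutral_left)
    have k: "k \<noteq> 0" using that assms by (auto intro: gr0I)
    show "prime_factors k \<subseteq> prime_factors (m * n)"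
      using that assms by (intro dvd_prime_factors) auto
    show "\<forall>p\<in>prime_factors (m * n) - prime_factors k. z p ^ multiplicity p k = 1"
      using k by (auto simp: in_prime_factors_iff not_dvd_imp_multiplicity_0)
  qed simp
  show ?thesis
    unfolding eq[of m, OF dvd_triv_left] eq[of n, OF dvd_triv_right] eq[of "m * n", OF dvd_refl]
      prod.distrib[symmetric]
    by (intro prod.cong refl)
       (use assms in \<open>auto simp: prime_elem_multiplicity_mult_distrib in_prime_factors_iff power_add\<close>)
qed

lemma torus_char_1 [simp]: "torus_char z (Suc 0) = 1"
  by (simp add: torus_char_def)

lemma torus_char_prime: "prime p \<Longrightarrow> torus_char z p = z p"
  by (simp add: torus_char_def prime_prime_factors)

lemma torus_char_prod_primes:
  assumes "finite A" "A \<subseteq> {p. prime p}"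
  shows "torus_char z (\<Prod>A) = (\<Prod>p\<in>A. z p)"
  using assms
proof (induction A)
  case (insert p A)
  have "\<Prod>A > 0" using insert by (intro prod_pos) (auto simp: prime_gt_0_nat)
  with insert show ?case by (simp add: torus_char_mult prime_gt_0_nat torus_char_prime)
qed simp

text \<open>Both sides are completely multiplicative and agree at primes. Rotating by this point of
  the torus therefore translates a Dirichlet polynomial vertically by \<tau>, so that Haar
  invariance becomes invariance under vertical translation.\<close>

lemma torus_char_imaginary_shift:
  assumes "n \<ge> 1"
  shows "torus_char (\<lambda>p. cis (- \<tau> * ln (real p))) n = cis (- \<tau> * ln (real n))"
  using assms
proof (induction n rule: prime_divisors_induct)
  case (factor p n)
  show ?case
  proof (cases "n = 0")
    case False
    have "p > 0" using factor by (simp add: prime_gt_0_nat)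
    with False factor show ?thesis
      by (simp add: torus_char_mult torus_char_prime ln_mult cis_mult algebra_simps)
  qed (use factor in auto)
qed auto

section \<open>Hardy norms\<close>

text \<open>Writing the second factor as \<open>y powr (q - 1)\<close> avoids the conjugate
  exponent, so that q = 1 is included.\<close>

lemma young_powr:
  fixes x y q :: real
  assumes "q \<ge> 1" "x \<ge> 0" "y \<ge> 0"
  shows "x * y powr (q - 1) \<le> x powr q / q + (1 - 1 / q) * y powr q"
proof (cases "x = 0 \<or> y = 0")
  case False
  hence "(x powr q) powr (1 / q) * (y powr q) powr (1 - 1 / q) \<le> 1 / q * x powr q + (1 - 1 / q) * y powr q"
    using assms by (intro Youngs_inequality_0) auto
  moreover have "q * (1 - 1 / q) = q - 1" using assms by (simp add: field_simps)
  ultimately show ?thesis using assms False by (simp add: powr_powr)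
qed (use assms in auto)

text \<open>The inequality yields Lyapunov's inequality and convexity of powers; the equality case
  is the source of all strictness in the comparison of the test functions.\<close>

lemma bernoulli_powr:
  fixes y s :: real
  assumes s: "s > 1" and y: "y \<ge> 0"
  shows "1 + s * (y - 1) \<le> y powr s" and "1 + s * (y - 1) = y powr s \<Longrightarrow> y = 1"
proof -
  have "1 + s * (y - 1) < y powr s \<or> y = 1"
  proof (cases "y = 0 \<or> y = 1")
    case True
    thus ?thesis using s by auto
  next
    case False
    define u where "u = y powr s"
    have u: "u > 0" "u \<noteq> 1" using False y s by (auto simp: u_def powr_eq_one_iff_gen)
    \<comment> \<open>The claim is the weighted inequality of arithmetic and geometric means for u
      and 1 with weights 1 / s and 1 - 1 / s; m is the arithmetic mean and y the geometric
      one.\<close>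
    define m where "m = u / s + (1 - 1 / s)"
    have m: "m > 0" using u s unfolding m_def by (intro add_pos_pos) auto
    have m1: "m \<noteq> 1" using u s by (simp add: m_def field_simps)
    \<comment> \<open>Averaged with the two weights, the right-hand sides cancel to 0. Strictness
      comes from the second inequality, since m differs from 1.\<close>
    have "ln (u / m) \<le> u / m - 1" "ln (1 / m) < 1 / m - 1"
      using u m m1 ln_le_minus_one[of "u / m"] ln_le_minus_one[of "1 / m"] ln_eq_minus_one[of "1 / m"]
      by (auto simp: less_le)
    hence "1 / s * ln (u / m) + (1 - 1 / s) * ln (1 / m) < 1 / s * (u / m - 1) + (1 - 1 / s) * (1 / m - 1)"
      using s by (intro add_le_less_mono mult_left_mono mult_strict_left_mono) auto
    also have "\<dots> = (u / s + (1 - 1 / s)) / m - 1" using m s by (simp add: field_simps)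
    also have "\<dots> = 0" unfolding m_def[symmetric] using m by simp
    also have "1 / s * ln (u / m) + (1 - 1 / s) * ln (1 / m) = ln u / s - ln m"
      using u m s by (simp add: ln_div field_simps)
    also have "ln u / s = ln y" using s False y by (simp add: u_def ln_powr)
    finally have "s * y < s * m" using m False y s by simp
    also have "s * m = u + (s - 1)" using s by (simp add: m_def field_simps)
    finally show ?thesis by (simp add: u_def algebra_simps)
  qed
  thus "1 + s * (y - 1) \<le> y powr s" "1 + s * (y - 1) = y powr s \<Longrightarrow> y = 1" by auto
qed

text \<open>Bernoulli's inequality, scaled by the mean m, says that the power lies above its tangent
  at m; averaging x and y cancels the linear terms.\<close>

lemma powr_convex_nonneg:
  fixes x y \<theta> q :: real
  assumes q: "q \<ge> 1" and xy: "x \<ge> 0" "y \<ge> 0" and \<theta>: "0 \<le> \<theta>" "\<theta> \<le> 1"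
  shows "(\<theta> * x + (1 - \<theta>) * y) powr q \<le> \<theta> * x powr q + (1 - \<theta>) * y powr q"
proof -
  define m where "m = \<theta> * x + (1 - \<theta>) * y"
  have m0: "m \<ge> 0" unfolding m_def using xy \<theta> by simp
  show ?thesis
  proof (cases "m = 0 \<or> q = 1")
    case True
    thus ?thesis unfolding m_def[symmetric] using xy \<theta> m0 by (auto simp: m_def)
  next
    case False
    hence m: "m > 0" and q1: "q > 1" using m0 q by auto
    have tangent: "m powr q * (1 + q * (z / m - 1)) \<le> z powr q" if "z \<ge> 0" for z
      using bernoulli_powr(1)[OF q1, of "z / m"] that m by (simp add: powr_divide field_simps)
    have "\<theta> * (m powr q * (1 + q * (x / m - 1))) + (1 - \<theta>) * (m powr q * (1 + q * (y / m - 1)))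
        \<le> \<theta> * x powr q + (1 - \<theta>) * y powr q"
      using \<theta> xy by (intro add_mono mult_left_mono tangent) auto
    also have "\<theta> * (m powr q * (1 + q * (x / m - 1))) + (1 - \<theta>) * (m powr q * (1 + q * (y / m - 1)))
        = m powr q * (1 + q * ((\<theta> * x + (1 - \<theta>) * y) / m - 1))"
      by (simp add: algebra_simps add_divide_distrib diff_divide_distrib)
    also have "\<dots> = m powr q" unfolding m_def[symmetric] using m by simp
    finally show ?thesis by (simp add: m_def)
  qed
qed

text \<open>Bernoulli's inequality is applied to \<open>f powr q\<close> divided by its mean, with exponent \<open>p / q\<close>.\<close>

lemma (in prob_space) lyapunov_inequality:
  fixes f :: "'a \<Rightarrow> real"
  assumes qp: "1 \<le> q" "q < p" and f: "\<And>x. f x \<ge> 0"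
    and int: "integrable M (\<lambda>x. f x powr q)" "integrable M (\<lambda>x. f x powr p)"
  shows "(\<integral>x. f x powr q \<partial>M) powr (1 / q) \<le> (\<integral>x. f x powr p \<partial>M) powr (1 / p)"
    and "(\<integral>x. f x powr q \<partial>M) powr (1 / q) = (\<integral>x. f x powr p \<partial>M) powr (1 / p) \<Longrightarrow>
         (AE x in M. f x powr q = (\<integral>x. f x powr q \<partial>M))"
proof -
  define X where "X = (\<integral>x. f x powr q \<partial>M)"
  define Y where "Y = (\<integral>x. f x powr p \<partial>M)"
  define s where "s = p / q"
  have s: "s > 1" using qp by (simp add: s_def)
  have X0: "X \<ge> 0" and Y0: "Y \<ge> 0" by (simp_all add: X_def Y_def)
  have "X powr (1 / q) \<le> Y powr (1 / p) \<and> (X powr (1 / q) = Y powr (1 / p) \<longrightarrow> (AE x in M. f x powr q = X))"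
  proof (cases "X = 0")
    case True
    hence "AE x in M. f x powr q = 0"
      using int(1) by (subst (asm) X_def, subst (asm) integral_nonneg_eq_0_iff_AE) auto
    with True show ?thesis by simp
  next
    case False
    hence X: "X > 0" using X0 by simp
    \<comment> \<open>The defect in Bernoulli's inequality. Since \<open>f powr q / X\<close> has
      mean 1, the linear part integrates to 1 and the defect to Y / X^s - 1. Its sign gives the
      inequality, its vanishing the equality case.\<close>
    let ?d = "\<lambda>x. (f x powr q / X) powr s - (1 + s * (f x powr q / X - 1))"
    have pw: "(f x powr q / X) powr s = f x powr p / X powr s" for x
      using X f[of x] qp by (simp add: powr_divide powr_powr s_def)
    have d0: "?d x \<ge> 0" for x
      using bernoulli_powr(1)[OF s, of "f x powr q / X"] X by simp
    define D where "D = (\<integral>x. ?d x \<partial>M)"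
    have int_d: "integrable M ?d"
      unfolding pw using int by auto
    have D: "D = Y / X powr s - 1"
      unfolding D_def pw using int X by (simp add: prob_space X_def[symmetric] Y_def[symmetric])
    have D0: "D \<ge> 0" unfolding D_def using d0 by simp
    have AE: "AE x in M. f x powr q = X" if "D = 0"
    proof -
      have "AE x in M. ?d x = 0"
        using that integral_nonneg_eq_0_iff_AE[OF int_d] d0 by (auto simp: D_def)
      thus ?thesis
      proof eventually_elim
        case (elim x)
        hence "f x powr q / X = 1" using bernoulli_powr(2)[OF s, of "f x powr q / X"] X by simp
        thus ?case using X by simp
      qed
    qed
    have X_eq: "X powr (1 / q) = (X powr s) powr (1 / p)" using qp by (simp add: powr_powr s_def)
    have "1 \<le> Y / X powr s" using D D0 by simp
    hence "X powr s \<le> Y" using X by (simp add: pos_le_divide_eq)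
    hence "(X powr s) powr (1 / p) \<le> Y powr (1 / p)"
      using qp X by (intro powr_mono2) auto
    moreover have "D = 0" if "(X powr s) powr (1 / p) = Y powr (1 / p)"
    proof -
      have "((X powr s) powr (1 / p)) powr p = (Y powr (1 / p)) powr p" using that by simp
      hence "X powr s = Y" using qp Y0 by (simp add: powr_powr)
      moreover have "X powr s > 0" using X by simp
      ultimately show ?thesis by (simp add: D)
    qed
    ultimately show ?thesis using AE X_eq by auto
  qed
  thus "(\<integral>x. f x powr q \<partial>M) powr (1 / q) \<le> (\<integral>x. f x powr p \<partial>M) powr (1 / p)"
    "(\<integral>x. f x powr q \<partial>M) powr (1 / q) = (\<integral>x. f x powr p \<partial>M) powr (1 / p) \<Longrightarrow>
         (AE x in M. f x powr q = (\<integral>x. f x powr q \<partial>M))"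
    by (auto simp: X_def Y_def)
qed

text \<open>With a and b bounding the two norms, f + g is (a + b) times a convex combination of f /
  a and g / b, to which convexity of the power applies pointwise.\<close>

lemma minkowski_integral_aux:
  fixes f g :: "'a \<Rightarrow> real"
  assumes q: "q \<ge> 1" and nonneg: "\<And>x. f x \<ge> 0" "\<And>x. g x \<ge> 0" and ab: "a > 0" "b > 0"
    and int: "integrable M (\<lambda>x. f x powr q)" "integrable M (\<lambda>x. g x powr q)"
    and meas: "h \<in> borel_measurable M" and h: "\<And>x. h x \<ge> 0" "\<And>x. h x \<le> f x + g x"
    and le: "(\<integral>x. f x powr q \<partial>M) \<le> a powr q" "(\<integral>x. g x powr q \<partial>M) \<le> b powr q"
  shows "integrable M (\<lambda>x. h x powr q) \<and> (\<integral>x. h x powr q \<partial>M) \<le> (a + b) powr q"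
proof -
  define \<theta> where "\<theta> = a / (a + b)"
  have \<theta>: "0 \<le> \<theta>" "\<theta> \<le> 1" "(a + b) * \<theta> = a" "(a + b) * (1 - \<theta>) = b"
    using ab by (auto simp: \<theta>_def field_simps)
  define G where "G = (\<lambda>x. (a + b) powr q * (\<theta> * (f x powr q / a powr q) + (1 - \<theta>) * (g x powr q / b powr q)))"
  have intG: "integrable M G" unfolding G_def using int by auto
  have hG: "h x powr q \<le> G x" for x
  proof -
    have "h x powr q \<le> (f x + g x) powr q" using h q by (intro powr_mono2) auto
    also have "f x + g x = (a + b) * \<theta> * (f x / a) + (a + b) * (1 - \<theta>) * (g x / b)"
      unfolding \<theta> using ab by simp
    also have "\<dots> = (a + b) * (\<theta> * (f x / a) + (1 - \<theta>) * (g x / b))"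
      by (simp only: distrib_left mult.assoc)
    also have "\<dots> powr q = (a + b) powr q * (\<theta> * (f x / a) + (1 - \<theta>) * (g x / b)) powr q"
      using ab nonneg \<theta> by (simp add: powr_mult)
    also have "(\<theta> * (f x / a) + (1 - \<theta>) * (g x / b)) powr q \<le> \<theta> * (f x / a) powr q + (1 - \<theta>) * (g x / b) powr q"
      using ab nonneg \<theta> by (intro powr_convex_nonneg q) auto
    also have "\<dots> = \<theta> * (f x powr q / a powr q) + (1 - \<theta>) * (g x powr q / b powr q)"
      using ab nonneg by (simp add: powr_divide)
    finally show ?thesis using ab by (simp add: G_def)
  qed
  have int_h: "integrable M (\<lambda>x. h x powr q)"
    by (rule Bochner_Integration.integrable_bound[OF intG])
       (use meas hG in \<open>auto intro!: AE_I2 intro: order_trans[OF _ abs_ge_self]\<close>)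
  have "(\<integral>x. h x powr q \<partial>M) \<le> (\<integral>x. G x \<partial>M)"
    by (rule integral_mono[OF int_h intG hG])
  also have "\<dots> = (a + b) powr q * (\<theta> * ((\<integral>x. f x powr q \<partial>M) / a powr q) +
       (1 - \<theta>) * ((\<integral>x. g x powr q \<partial>M) / b powr q))"
    unfolding G_def using int by simp
  also have "\<dots> \<le> (a + b) powr q * (\<theta> * 1 + (1 - \<theta>) * 1)"
    using ab le \<theta> by (intro mult_left_mono add_mono) (auto simp: field_simps)
  also have "\<dots> = (a + b) powr q" using ab by (simp add: field_simps)
  finally show ?thesis using int_h by blast
qed

lemma minkowski_integral:
  fixes f g :: "'a \<Rightarrow> real"
  assumes q: "q \<ge> 1" and nonneg: "\<And>x. f x \<ge> 0" "\<And>x. g x \<ge> 0"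
    and int: "integrable M (\<lambda>x. f x powr q)" "integrable M (\<lambda>x. g x powr q)"
    and meas: "h \<in> borel_measurable M" and h: "\<And>x. h x \<ge> 0" "\<And>x. h x \<le> f x + g x"
  shows "(\<integral>x. h x powr q \<partial>M) powr (1 / q) \<le>
     (\<integral>x. f x powr q \<partial>M) powr (1 / q) + (\<integral>x. g x powr q \<partial>M) powr (1 / q)"
proof (rule field_le_epsilon)
  fix e :: real assume e: "e > 0"
  \<comment> \<open>The padding by e / 2 keeps a and b positive, as divisors, even when a norm is
    0.\<close>
  define a where "a = (\<integral>x. f x powr q \<partial>M) powr (1 / q) + e / 2"
  define b where "b = (\<integral>x. g x powr q \<partial>M) powr (1 / q) + e / 2"
  have ab: "a > 0" "b > 0" using e by (auto simp: a_def b_def add_nonneg_pos)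
  have *: "X \<le> (X powr (1 / q) + e / 2) powr q" if "X \<ge> 0" for X
  proof -
    have "X = (X powr (1 / q)) powr q" using that q by (simp add: powr_powr)
    also have "\<dots> \<le> (X powr (1 / q) + e / 2) powr q" using q e by (intro powr_mono2) auto
    finally show ?thesis .
  qed
  have "(\<integral>x. h x powr q \<partial>M) \<le> (a + b) powr q"
    using minkowski_integral_aux[OF q nonneg ab int meas h] * by (simp add: a_def b_def)
  hence "(\<integral>x. h x powr q \<partial>M) powr (1 / q) \<le> ((a + b) powr q) powr (1 / q)"
    using q by (intro powr_mono2) auto
  also have "\<dots> = a + b" using ab q by (simp add: powr_powr)
  finally show "(\<integral>x. h x powr q \<partial>M) powr (1 / q) \<le>
     (\<integral>x. f x powr q \<partial>M) powr (1 / q) + (\<integral>x. g x powr q \<partial>M) powr (1 / q) + e"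
    by (simp add: a_def b_def)
qed

section \<open>The Bohr lift \<open>torus_lift\<close> and Hardy norms of polynomials\<close>

definition torus_lift :: "(nat \<Rightarrow> complex) \<Rightarrow> (nat \<Rightarrow> complex) \<Rightarrow> complex" where
  "torus_lift a z = (\<Sum>n | a n \<noteq> 0. a n * torus_char z n)"

lemma torus_lift_eq_sum:
  assumes "finite S" "\<And>n. a n \<noteq> 0 \<Longrightarrow> n \<in> S"
  shows "torus_lift a z = (\<Sum>n\<in>S. a n * torus_char z n)"
  unfolding torus_lift_def by (rule sum.mono_neutral_left) (use assms in auto)

lemma measurable_torus_lift [measurable]: "torus_lift a \<in> borel_measurable torus_measure"
  unfolding torus_lift_def[abs_def] by measurable

lemma norm_torus_lift_le:
  "z \<in> space torus_measure \<Longrightarrow> cmod (torus_lift a z) \<le> (\<Sum>n | a n \<noteq> 0. cmod (a n))"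
  unfolding torus_lift_def by (rule sum_norm_le) (simp add: norm_mult norm_torus_char)

lemma torus_lift_diff:
  assumes "dirichlet_polynomial a" "dirichlet_polynomial b"
  shows "torus_lift (\<lambda>n. a n - b n) z = torus_lift a z - torus_lift b z"
proof -
  have "finite ({n. a n \<noteq> 0} \<union> {n. b n \<noteq> 0})" (is "finite ?S")
    using assms by (simp add: dirichlet_polynomial_def)
  note eq = torus_lift_eq_sum[OF this]
  have "torus_lift (\<lambda>n. a n - b n) z = (\<Sum>n\<in>?S. (a n - b n) * torus_char z n)" by (rule eq) auto
  also have "\<dots> = torus_lift a z - torus_lift b z"
    by (subst (1 2) eq) (auto simp: sum_subtractf left_diff_distrib)
  finally show ?thesis .
qed

lemma hardy_poly_norm_eq:
  "hardy_poly_norm p a = (\<integral>z. cmod (torus_lift a z) powr p \<partial>torus_measure) powr (1 / p)"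
  by (simp add: hardy_poly_norm_def torus_lift_def)

lemma integrable_torus_lift_powr:
  assumes "q > 0"
  shows "integrable torus_measure (\<lambda>z. cmod (torus_lift a z) powr q)"
  by (rule torus.P.integrable_const_bound[where B = "(\<Sum>n | a n \<noteq> 0. cmod (a n)) powr q"])
     (use assms in \<open>auto intro!: AE_I2 powr_mono2 norm_torus_lift_le\<close>)

lemma hardy_poly_norm_nonneg: "hardy_poly_norm p a \<ge> 0"
  by (simp add: hardy_poly_norm_eq)

lemma hardy_poly_norm_le_sum:
  assumes "p > 0"
  shows "hardy_poly_norm p a \<le> (\<Sum>n | a n \<noteq> 0. cmod (a n))"
proof -
  let ?S = "\<Sum>n | a n \<noteq> 0. cmod (a n)"
  have S0: "?S \<ge> 0" by (simp add: sum_nonneg)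
  have "(\<integral>z. cmod (torus_lift a z) powr p \<partial>torus_measure) \<le> (\<integral>z. ?S powr p \<partial>torus_measure)"
    using assms by (intro integral_mono_AE integrable_torus_lift_powr)
      (auto intro!: AE_I2 powr_mono2 norm_torus_lift_le)
  hence "hardy_poly_norm p a \<le> (?S powr p) powr (1 / p)"
    unfolding hardy_poly_norm_eq using assms by (intro powr_mono2) (auto simp: torus.P.prob_space)
  thus ?thesis using assms S0 by (simp add: powr_powr)
qed

lemma hardy_poly_norm_diff:
  assumes "p \<ge> 1" "dirichlet_polynomial a" "dirichlet_polynomial b"
  shows "hardy_poly_norm p (\<lambda>n. a n - b n) \<le> hardy_poly_norm p a + hardy_poly_norm p b"
  unfolding hardy_poly_norm_eq torus_lift_diff[OF assms(2,3)]
  by (rule minkowski_integral) (use assms(1) in \<open>auto intro: integrable_torus_lift_powr norm_triangle_ineq4\<close>)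

lemma hardy_poly_norm_mono:
  assumes "1 \<le> q" "q \<le> p"
  shows "hardy_poly_norm q a \<le> hardy_poly_norm p a"
proof (cases "q = p")
  case False
  thus ?thesis unfolding hardy_poly_norm_eq
    by (intro torus.P.lyapunov_inequality(1)) (use assms in \<open>auto intro: integrable_torus_lift_powr\<close>)
qed simp

lemma hardy_poly_norm_single:
  assumes "p > 0"
  shows "hardy_poly_norm p (\<lambda>n. if n = k then c else 0) = cmod c"
proof -
  have lift: "torus_lift (\<lambda>n. if n = k then c else 0) z = c * torus_char z k" for z
    by (subst torus_lift_eq_sum[of "{k}"]) (auto split: if_splits)
  have "(\<integral>z. cmod (torus_lift (\<lambda>n. if n = k then c else 0) z) powr p \<partial>torus_measure) =
      (\<integral>z. cmod c powr p \<partial>torus_measure)"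
    unfolding lift by (intro Bochner_Integration.integral_cong) (auto simp: norm_mult norm_torus_char)
  thus ?thesis using assms by (simp add: hardy_poly_norm_eq torus.P.prob_space powr_powr)
qed

text \<open>
  Duality: the multiplier is tested against \<open>g = \<bar>Q\<bar> powr (q - 2) * cnj Q\<close>, where \<open>Q\<close> is the lift of
  the image of \<open>a\<close>; rotating \<open>a\<close> along the flow \<open>p powr (- \<i> * \<tau>)\<close> makes the pairing
  with \<open>g\<close> an exponential sum in \<open>\<tau>\<close>.
\<close>

lemma hardy_poly_norm_multiplier:
  assumes q: "q \<ge> 1" and mult: "dirichlet_multiplier A m C" and C: "C > 0"
    and a: "dirichlet_polynomial a" "\<And>n. a n \<noteq> 0 \<Longrightarrow> n \<in> A"
  shows "hardy_poly_norm q (\<lambda>n. m n * a n) \<le> C * hardy_poly_norm q a"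
proof -
  define S where "S = {n. a n \<noteq> 0}"
  have S: "finite S" "S \<subseteq> A" using a by (auto simp: S_def dirichlet_polynomial_def)
  have S1: "n \<ge> 1" if "n \<in> S" for n
    using that a(1) by (cases n) (auto simp: S_def dirichlet_polynomial_def)
  define Q where "Q = torus_lift (\<lambda>n. m n * a n)"
  define F where "F = torus_lift a"
  have Q_eq: "Q z = (\<Sum>n\<in>S. m n * a n * torus_char z n)" for z
    unfolding Q_def by (rule torus_lift_eq_sum[OF S(1)]) (auto simp: S_def)
  have F_eq: "F z = (\<Sum>n\<in>S. a n * torus_char z n)" for z
    unfolding F_def by (rule torus_lift_eq_sum[OF S(1)]) (auto simp: S_def)
  have [measurable]: "Q \<in> borel_measurable torus_measure" "F \<in> borel_measurable torus_measure"
    unfolding Q_def F_def by measurable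
  define g where "g = (\<lambda>z. of_real (cmod (Q z) powr (q - 2)) * cnj (Q z))"
  \<comment> \<open>At zeros of Q both sides vanish even for q = 1, because
    \<open>0 powr 0 = 0\<close>.\<close>
  have norm_g: "cmod (g z) = cmod (Q z) powr (q - 1)" for z
    by (cases "Q z = 0") (simp_all add: g_def norm_mult powr_mult_base mult.commute)
  have Qg: "Q z * g z = of_real (cmod (Q z) powr q)" for z
  proof (cases "Q z = 0")
    case False
    have "Q z * g z = of_real (cmod (Q z) powr (q - 2)) * (Q z * cnj (Q z))" by (simp add: g_def)
    also have "Q z * cnj (Q z) = of_real (cmod (Q z) powr 2)"
      using False complex_norm_square[of "Q z"] by simp
    also have "of_real (cmod (Q z) powr (q - 2)) * \<dots> = complex_of_real (cmod (Q z) powr q)"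
      by (simp only: of_real_mult[symmetric] powr_add[symmetric]) simp
    finally show ?thesis .
  qed simp
  have [measurable]: "cnj \<in> borel_measurable borel"
    by (intro borel_measurable_continuous_onI continuous_intros)
  have [measurable]: "g \<in> borel_measurable torus_measure" unfolding g_def by measurable
  define K where "K = (\<Sum>n | m n * a n \<noteq> 0. cmod (m n * a n))"
  have QK: "cmod (Q z) \<le> K" if "z \<in> space torus_measure" for z
    unfolding Q_def K_def using that by (rule norm_torus_lift_le)
  have int_char: "integrable torus_measure (\<lambda>z. torus_char z n * g z)" for n
    by (rule torus.P.integrable_const_bound[where B = "K powr (q - 1)"])
       (use q in \<open>auto intro!: AE_I2 powr_mono2 QK simp: norm_mult norm_torus_char norm_g\<close>)
  have pairing: "(\<Sum>n\<in>S. b n * (\<integral>z. torus_char z n * g z \<partial>torus_measure)) =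
      (\<integral>z. (\<Sum>n\<in>S. b n * (torus_char z n * g z)) \<partial>torus_measure)" for b
    using int_char by (subst Bochner_Integration.integral_sum) auto
  define c where "c = (\<lambda>n. a n * (\<integral>z. torus_char z n * g z \<partial>torus_measure))"
  define X where "X = (\<integral>z. cmod (F z) powr q \<partial>torus_measure)"
  define Y where "Y = (\<integral>z. cmod (Q z) powr q \<partial>torus_measure)"
  \<comment> \<open>Young's inequality for C * |F| and |Q| bounds the pairing of every rotated F
    with g by B. The multiplied sum is the pairing of Q with g, which is Y, so Y <= C * B; the share
    (1 - 1 / q) * Y of C * B is then absorbed on the left.\<close>
  define B where "B = (C powr q * X / q + (1 - 1 / q) * Y) / C"
  have int_Q: "integrable torus_measure (\<lambda>z. cmod (Q z) powr q)"
    unfolding Q_def using q by (intro integrable_torus_lift_powr) auto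
  have "cmod (\<Sum>n\<in>S. c n * cis (- \<tau> * ln (real n))) \<le> B" for \<tau>
  proof -
    define w where "w = (\<lambda>p. cis (- \<tau> * ln (real p)))"
    have w: "cmod (w p) = 1" for p by (simp add: w_def)
    note [measurable] = measurable_torus_rotation[of w, OF w]
    have F_rot: "F (torus_rotation w z) = (\<Sum>n\<in>S. a n * cis (- \<tau> * ln (real n)) * torus_char z n)" for z
      unfolding F_eq torus_char_rotation w_def
      by (intro sum.cong refl) (simp only: torus_char_imaginary_shift S1 mult.assoc)
    have int_F: "integrable torus_measure (\<lambda>z. cmod (F (torus_rotation w z)) powr q)"
    proof (rule torus.P.integrable_const_bound[where B = "(\<Sum>n | a n \<noteq> 0. cmod (a n)) powr q"])
      show "AE z in torus_measure. norm (cmod (F (torus_rotation w z)) powr q) \<le> (\<Sum>n | a n \<noteq> 0. cmod (a n)) powr q"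
        using q measurable_space[OF measurable_torus_rotation[of w, OF w]]
        by (auto intro!: AE_I2 powr_mono2 norm_torus_lift_le simp: F_def)
    qed measurable
    have "(\<Sum>n\<in>S. c n * cis (- \<tau> * ln (real n)))
       = (\<integral>z. (\<Sum>n\<in>S. a n * cis (- \<tau> * ln (real n)) * (torus_char z n * g z)) \<partial>torus_measure)"
      unfolding pairing[symmetric] by (simp add: c_def mult_ac)
    also have "\<dots> = (\<integral>z. F (torus_rotation w z) * g z \<partial>torus_measure)"
      unfolding F_rot sum_distrib_right by (simp add: mult.assoc)
    also have "cmod \<dots> \<le> (\<integral>z. (C powr q * cmod (F (torus_rotation w z)) powr q / q + (1 - 1 / q) * cmod (Q z) powr q) / C \<partial>torus_measure)"
    proof (rule order_trans[OF integral_norm_bound integral_mono], rule integrable_norm)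
      show "integrable torus_measure (\<lambda>z. F (torus_rotation w z) * g z)"
        unfolding F_rot sum_distrib_right mult.assoc using int_char by auto
      show "integrable torus_measure (\<lambda>z. (C powr q * cmod (F (torus_rotation w z)) powr q / q + (1 - 1 / q) * cmod (Q z) powr q) / C)"
        using int_F int_Q by auto
      fix z
      have "C * cmod (F (torus_rotation w z)) * cmod (Q z) powr (q - 1) \<le>
         (C * cmod (F (torus_rotation w z))) powr q / q + (1 - 1 / q) * cmod (Q z) powr q"
        using q C by (intro young_powr) auto
      thus "norm (F (torus_rotation w z) * g z) \<le> (C powr q * cmod (F (torus_rotation w z)) powr q / q + (1 - 1 / q) * cmod (Q z) powr q) / C"
        using C by (simp add: norm_mult norm_g powr_mult field_simps)
    qed
    also have "\<dots> = (C powr q * (\<integral>z. cmod (F (torus_rotation w z)) powr q \<partial>torus_measure) / q + (1 - 1 / q) * Y) / C"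
      using int_F int_Q by (simp add: Y_def)
    also have "(\<integral>z. cmod (F (torus_rotation w z)) powr q \<partial>torus_measure) = X"
      unfolding X_def by (rule integral_torus_rotation[OF w]) measurable
    finally show ?thesis unfolding B_def .
  qed
  hence "cmod (\<Sum>n\<in>S. m n * c n) \<le> C * B"
    using mult S unfolding dirichlet_multiplier_def by blast
  also have "(\<Sum>n\<in>S. m n * c n) = (\<integral>z. (\<Sum>n\<in>S. m n * a n * (torus_char z n * g z)) \<partial>torus_measure)"
    unfolding pairing[symmetric] by (simp add: c_def mult_ac)
  also have "\<dots> = (\<integral>z. Q z * g z \<partial>torus_measure)"
    unfolding Q_eq sum_distrib_right by (simp add: mult.assoc)
  also have "\<dots> = of_real Y" unfolding Qg Y_def by simp
  finally have "Y \<le> C powr q * X / q + (1 - 1 / q) * Y"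
    using C by (simp add: B_def)
  hence YX: "Y \<le> C powr q * X" using q by (simp add: field_simps)
  have X0: "X \<ge> 0" and Y0: "Y \<ge> 0" by (simp_all add: X_def Y_def)
  have "Y powr (1 / q) \<le> (C powr q * X) powr (1 / q)"
    using YX Y0 q by (intro powr_mono2) auto
  also have "\<dots> = C * X powr (1 / q)" using C q X0 by (simp add: powr_mult powr_powr)
  finally show ?thesis by (simp add: hardy_poly_norm_eq X_def Y_def Q_def F_def)
qed

lemma norm_coefficient_le_hardy_poly_norm:
  assumes "q \<ge> 1" "dirichlet_polynomial a"
  shows "cmod (a k) \<le> hardy_poly_norm q a"
proof (cases "k = 0")
  case True
  thus ?thesis using assms(2) by (simp add: dirichlet_polynomial_def hardy_poly_norm_nonneg)
next
  case False
  have "hardy_poly_norm q (\<lambda>n. (if n = k then 1 else 0) * a n) \<le> 1 * hardy_poly_norm q a"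
  proof (rule hardy_poly_norm_multiplier[OF assms(1) dirichlet_multiplier_coefficient _ assms(2)])
    show "n \<in> {1..}" if "a n \<noteq> 0" for n
      using that assms(2) by (cases n) (auto simp: dirichlet_polynomial_def)
  qed (use False in auto)
  also have "(\<lambda>n. (if n = k then 1 else 0) * a n) = (\<lambda>n. if n = k then a k else 0)" by auto
  finally show ?thesis using assms(1) by (simp add: hardy_poly_norm_single)
qed

section \<open>Completions\<close>

lemma dirichlet_polynomial_diff:
  assumes "dirichlet_polynomial a" "dirichlet_polynomial b"
  shows "dirichlet_polynomial (\<lambda>n. a n - b n)"
proof -
  have "finite ({n. a n \<noteq> 0} \<union> {n. b n \<noteq> 0})" using assms by (simp add: dirichlet_polynomial_def)
  moreover have "{n. a n - b n \<noteq> 0} \<subseteq> {n. a n \<noteq> 0} \<union> {n. b n \<noteq> 0}" by auto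
  ultimately show ?thesis
    using assms by (auto simp: dirichlet_polynomial_def intro: finite_subset)
qed

lemma dirichlet_polynomial_mult:
  assumes "dirichlet_polynomial a"
  shows "dirichlet_polynomial (\<lambda>n. m n * a n)"
proof -
  have "{n. m n * a n \<noteq> 0} \<subseteq> {n. a n \<noteq> 0}" by auto
  thus ?thesis using assms by (auto simp: dirichlet_polynomial_def intro: finite_subset)
qed

text \<open>
  The contractive Gaussian multipliers \<open>exp (- (\<delta> * ln n)\<^sup>2 / 2)\<close> decay faster than the
  coefficient bound \<open>w\<close> can grow, and tend to 1 as \<open>\<delta>\<close> tends to 0. This forces Cauchy sequences
  with vanishing coefficients to be null sequences.
\<close>

locale dirichlet_norm =
  fixes N :: "(nat \<Rightarrow> complex) \<Rightarrow> real" and w :: "nat \<Rightarrow> real"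
  assumes nonneg: "dirichlet_polynomial a \<Longrightarrow> N a \<ge> 0"
    and le_sum: "dirichlet_polynomial a \<Longrightarrow> N a \<le> (\<Sum>n | a n \<noteq> 0. cmod (a n))"
    and diff: "dirichlet_polynomial a \<Longrightarrow> dirichlet_polynomial b \<Longrightarrow> N (\<lambda>n. a n - b n) \<le> N a + N b"
    and gaussian: "dirichlet_polynomial a \<Longrightarrow>
      N (\<lambda>n. of_real (exp (- (\<delta> * ln (real n))\<^sup>2 / 2)) * a n) \<le> N a"
    and coefficient: "dirichlet_polynomial a \<Longrightarrow> cmod (a n) \<le> w n * N a"
    and weight_nonneg: "w n \<ge> 0"
    and summable_weight: "\<delta> > 0 \<Longrightarrow> summable (\<lambda>n. exp (- (\<delta> * ln (real n))\<^sup>2 / 2) * w n)"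
begin

lemma le_sum_superset:
  assumes a: "dirichlet_polynomial a" and S: "finite S" "\<And>n. a n \<noteq> 0 \<Longrightarrow> n \<in> S"
  shows "N a \<le> (\<Sum>n\<in>S. cmod (a n))"
  using le_sum[OF a] by (rule order_trans) (rule sum_mono2, use S in auto)

text \<open>The locale assumes the triangle inequality for differences only, so a is written as (a -
  b) - (0 - b).\<close>

lemma triangle:
  assumes a: "dirichlet_polynomial a" and b: "dirichlet_polynomial b"
  shows "N a \<le> N (\<lambda>n. a n - b n) + N b"
proof -
  have z: "dirichlet_polynomial (\<lambda>n. 0)" by (simp add: dirichlet_polynomial_def)
  have "N (\<lambda>n. 0 - b n) \<le> N (\<lambda>n. 0) + N b" by (rule diff[OF z b])
  moreover have "N (\<lambda>n. 0) \<le> 0" using le_sum[OF z] by simp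
  moreover have "N (\<lambda>n. (a n - b n) - (0 - b n)) \<le> N (\<lambda>n. a n - b n) + N (\<lambda>n. 0 - b n)"
    by (intro diff dirichlet_polynomial_diff a b z)
  ultimately show ?thesis by simp
qed

text \<open>Two limits in a fixed order: with i and the smoothing parameter \<delta> fixed, j tends
  to infinity; then \<delta> tends to 0 for the single polynomial \<open>R i\<close>.\<close>

lemma tendsto_zero_of_coefficients:
  assumes R: "\<And>k. dirichlet_polynomial (R k)"
    and cauchy: "\<And>\<epsilon>. \<epsilon> > 0 \<Longrightarrow> \<exists>K. \<forall>i\<ge>K. \<forall>j\<ge>K. N (\<lambda>n. R i n - R j n) < \<epsilon>"
    and lim: "\<And>n. (\<lambda>k. R k n) \<longlonglongrightarrow> 0"
  shows "(\<lambda>k. N (R k)) \<longlonglongrightarrow> 0"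
proof (rule LIMSEQ_I)
  define e where "e = (\<lambda>\<delta> n. exp (- (\<delta> * ln (real n))\<^sup>2 / 2))"
  define V where "V = (\<lambda>\<delta> (a :: nat \<Rightarrow> complex) n. of_real (e \<delta> n) * a n)"
  have V: "dirichlet_polynomial (V \<delta> a)" if "dirichlet_polynomial a" for \<delta> a
    unfolding V_def using that by (rule dirichlet_polynomial_mult)
  have NV: "N (V \<delta> a) \<le> N a" if "dirichlet_polynomial a" for \<delta> a
    unfolding V_def e_def using that by (rule gaussian)
  have e: "e \<delta> n \<ge> 0" "e \<delta> n \<le> 1" for \<delta> n by (simp_all add: e_def)
  fix r :: real assume r: "r > 0"
  obtain K where K: "N (\<lambda>n. R i n - R j n) < r / 2" if "i \<ge> K" "j \<ge> K" for i j
    using cauchy[of "r / 2"] r by auto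
  have "N (R i) \<le> r / 2" if i: "i \<ge> K" for i
  proof -
    \<comment> \<open>The smoothed \<open>R i\<close> differs from the smoothed \<open>R j\<close>
      by at most r / 2, and the absolute coefficient sum of the latter tends to 0 as j grows, by
      dominated convergence for series.\<close>
    have smoothed: "N (V \<delta> (R i)) \<le> r / 2" if \<delta>: "\<delta> > 0" for \<delta>
    proof -
      \<comment> \<open>M bounds the norms of the tail of the sequence, so that w * M dominates its
        coefficients and the Gaussian makes the majorant summable.\<close>
      define M where "M = r / 2 + N (R K)"
      have bound: "e \<delta> n * cmod (R j n) \<le> e \<delta> n * w n * M" if j: "j \<ge> K" for j n
      proof -
        have "N (R j) \<le> M" using triangle[OF R R, of j K] K[OF j order_refl] by (simp add: M_def)
        hence "cmod (R j n) \<le> w n * M"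
          using coefficient[OF R, of j n] weight_nonneg by (meson mult_left_mono order_trans)
        thus ?thesis using e by (simp add: mult.assoc mult_left_mono)
      qed
      have "(\<lambda>j. \<Sum>n. e \<delta> n * cmod (R j n)) \<longlonglongrightarrow> (\<Sum>n. 0)"
      proof (rule tannerys_theorem[THEN conjunct2, THEN conjunct2])
        show "(\<lambda>j. e \<delta> n * cmod (R j n)) \<longlonglongrightarrow> 0" for n
          using tendsto_mult_right_zero[OF tendsto_norm_zero[OF lim[of n]], of "e \<delta> n"] by simp
        show "\<forall>\<^sub>F (n, j) in sequentially \<times>\<^sub>F sequentially. norm (e \<delta> n * cmod (R j n)) \<le> e \<delta> n * w n * M"
          unfolding eventually_prod_sequentially using bound e by (auto intro!: exI[of _ K])
        show "summable (\<lambda>n. e \<delta> n * w n * M)"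
          unfolding e_def by (intro summable_mult2 summable_weight \<delta>)
      qed auto
      moreover have "N (V \<delta> (R i)) \<le> r / 2 + (\<Sum>n. e \<delta> n * cmod (R j n))" if j: "j \<ge> K" for j
      proof -
        have "N (V \<delta> (R i)) \<le> N (\<lambda>n. V \<delta> (R i) n - V \<delta> (R j) n) + N (V \<delta> (R j))"
          by (intro triangle V R)
        also have "(\<lambda>n. V \<delta> (R i) n - V \<delta> (R j) n) = V \<delta> (\<lambda>n. R i n - R j n)"
          by (simp add: V_def right_diff_distrib)
        also have "N (V \<delta> (\<lambda>n. R i n - R j n)) \<le> N (\<lambda>n. R i n - R j n)"
          by (intro NV dirichlet_polynomial_diff R)
        also have "N (\<lambda>n. R i n - R j n) \<le> r / 2" using K[OF i j] by simp
        also have "N (V \<delta> (R j)) \<le> (\<Sum>n | R j n \<noteq> 0. cmod (V \<delta> (R j) n))"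
          by (rule le_sum_superset[OF V[OF R]]) (use R[of j] in \<open>auto simp: dirichlet_polynomial_def V_def\<close>)
        also have "\<dots> = (\<Sum>n | R j n \<noteq> 0. e \<delta> n * cmod (R j n))"
          using e by (simp add: V_def norm_mult)
        also have "\<dots> = (\<Sum>n. e \<delta> n * cmod (R j n))"
          by (rule suminf_finite[symmetric]) (use R[of j] in \<open>auto simp: dirichlet_polynomial_def\<close>)
        finally show ?thesis by simp
      qed
      ultimately have "N (V \<delta> (R i)) \<le> r / 2 + (\<Sum>n. 0)"
        by (intro LIMSEQ_le_const[OF tendsto_add[OF tendsto_const]]) auto
      thus ?thesis by simp
    qed
    \<comment> \<open>The smoothing is removed along \<delta> = 1 / (k + 1); the support of
      \<open>R i\<close> is finite and fixed, so the error is a finite sum tending to 0.\<close>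
    have "N (R i) \<le> (\<Sum>n | R i n \<noteq> 0. (1 - e (inverse (real (Suc k))) n) * cmod (R i n)) + r / 2" for k
    proof -
      let ?\<delta> = "inverse (real (Suc k))"
      have "N (R i) \<le> N (\<lambda>n. R i n - V ?\<delta> (R i) n) + N (V ?\<delta> (R i))"
        by (intro triangle V R)
      also have "N (V ?\<delta> (R i)) \<le> r / 2" by (rule smoothed) simp
      also have "N (\<lambda>n. R i n - V ?\<delta> (R i) n) \<le> (\<Sum>n | R i n \<noteq> 0. cmod (R i n - V ?\<delta> (R i) n))"
        by (intro le_sum_superset dirichlet_polynomial_diff V R)
           (use R[of i] in \<open>auto simp: dirichlet_polynomial_def V_def\<close>)
      also have "\<dots> = (\<Sum>n | R i n \<noteq> 0. (1 - e ?\<delta> n) * cmod (R i n))"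
      proof (rule sum.cong)
        fix n
        have "R i n - V ?\<delta> (R i) n = of_real (1 - e ?\<delta> n) * R i n" by (simp add: V_def left_diff_distrib)
        thus "cmod (R i n - V ?\<delta> (R i) n) = (1 - e ?\<delta> n) * cmod (R i n)"
          using e(2)[of ?\<delta> n] by (simp only: norm_mult norm_of_real abs_of_nonneg diff_ge_0_iff_ge)
      qed simp
      finally show ?thesis by simp
    qed
    moreover have "(\<lambda>k. (\<Sum>n | R i n \<noteq> 0. (1 - e (inverse (real (Suc k))) n) * cmod (R i n)) + r / 2)
        \<longlonglongrightarrow> (\<Sum>n | R i n \<noteq> 0. (1 - exp (- (0 * ln (real n))\<^sup>2 / 2)) * cmod (R i n)) + r / 2"
      unfolding e_def by (intro tendsto_intros LIMSEQ_inverse_real_of_nat) auto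
    ultimately have "N (R i) \<le> (\<Sum>n | R i n \<noteq> 0. (1 - exp (- (0 * ln (real n))\<^sup>2 / 2)) * cmod (R i n)) + r / 2"
      by (intro LIMSEQ_le_const) auto
    thus ?thesis by simp
  qed
  hence "norm (N (R i) - 0) < r" if "i \<ge> K" for i
    using that nonneg[OF R[of i]] r by fastforce
  thus "\<exists>no. \<forall>n\<ge>no. norm (N (R n) - 0) < r" by blast
qed

lemma approximates_norm_diff:
  assumes P: "approximates N P f" and P': "approximates N P' f"
  shows "(\<lambda>k. N (P k) - N (P' k)) \<longlonglongrightarrow> 0"
proof -
  have poly: "dirichlet_polynomial (P k)" "dirichlet_polynomial (P' k)" for k
    using P P' by (auto simp: approximates_def)
  have "(\<lambda>k. N (\<lambda>n. P k n - P' k n)) \<longlonglongrightarrow> 0"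
  proof (rule tendsto_zero_of_coefficients)
    fix \<epsilon> :: real assume "\<epsilon> > 0"
    hence "\<epsilon> / 2 > 0" by simp
    obtain K where K: "\<forall>i\<ge>K. \<forall>j\<ge>K. N (\<lambda>n. P i n - P j n) < \<epsilon> / 2"
      using P \<open>\<epsilon> / 2 > 0\<close> unfolding approximates_def by blast
    obtain K' where K': "\<forall>i\<ge>K'. \<forall>j\<ge>K'. N (\<lambda>n. P' i n - P' j n) < \<epsilon> / 2"
      using P' \<open>\<epsilon> / 2 > 0\<close> unfolding approximates_def by blast
    show "\<exists>K. \<forall>i\<ge>K. \<forall>j\<ge>K. N (\<lambda>n. P i n - P' i n - (P j n - P' j n)) < \<epsilon>"
    proof (intro exI[of _ "max K K'"] allI impI)
      fix i j assume ij: "i \<ge> max K K'" "j \<ge> max K K'"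
      have "N (\<lambda>n. (P i n - P j n) - (P' i n - P' j n)) \<le> N (\<lambda>n. P i n - P j n) + N (\<lambda>n. P' i n - P' j n)"
        by (intro diff dirichlet_polynomial_diff poly)
      also have "N (\<lambda>n. P i n - P j n) < \<epsilon> / 2" using K ij by simp
      also have "N (\<lambda>n. P' i n - P' j n) < \<epsilon> / 2" using K' ij by simp
      finally show "N (\<lambda>n. P i n - P' i n - (P j n - P' j n)) < \<epsilon>" by (simp add: algebra_simps)
    qed
  next
    fix n
    have "(\<lambda>k. P k n - P' k n) \<longlonglongrightarrow> f n - f n"
      using P P' by (intro tendsto_diff) (auto simp: approximates_def)
    thus "(\<lambda>k. P k n - P' k n) \<longlonglongrightarrow> 0" by simp
  qed (intro dirichlet_polynomial_diff poly)
  thus ?thesis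
  proof (rule Lim_null_comparison[rotated], intro always_eventually allI)
    fix k
    \<comment> \<open>Subtraction from the zero polynomial supplies the symmetry N (- a) <= N a,
      which is not among the axioms.\<close>
    have "(\<lambda>n. 0 - (P k n - P' k n)) = (\<lambda>n. P' k n - P k n)" by auto
    moreover have "N (\<lambda>n. 0 - (P k n - P' k n)) \<le> N (\<lambda>n. 0) + N (\<lambda>n. P k n - P' k n)"
      by (intro diff dirichlet_polynomial_diff poly) (simp add: dirichlet_polynomial_def)
    moreover have "N (\<lambda>n. 0) \<le> 0" using le_sum[of "\<lambda>n. 0"] by (simp add: dirichlet_polynomial_def)
    ultimately show "norm (N (P k) - N (P' k)) \<le> N (\<lambda>n. P k n - P' k n)"
      using triangle[OF poly(1,2), of k k] triangle[OF poly(2,1), of k k] by auto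
  qed
qed

lemma approximates_norm_convergent:
  assumes P: "approximates N P f"
  shows "convergent (\<lambda>k. N (P k))"
proof -
  have poly: "dirichlet_polynomial (P k)" for k using P by (auto simp: approximates_def)
  have "Cauchy (\<lambda>k. N (P k))"
  proof (rule CauchyI)
    fix e :: real assume "e > 0"
    then obtain K where K: "\<forall>i\<ge>K. \<forall>j\<ge>K. N (\<lambda>n. P i n - P j n) < e"
      using P unfolding approximates_def by blast
    show "\<exists>M. \<forall>m\<ge>M. \<forall>n\<ge>M. norm (N (P m) - N (P n)) < e"
    proof (intro exI[of _ K] allI impI)
      fix i j assume "i \<ge> K" "j \<ge> K"
      hence "N (\<lambda>n. P i n - P j n) < e" "N (\<lambda>n. P j n - P i n) < e" using K by auto
      thus "norm (N (P i) - N (P j)) < e"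
        using triangle[OF poly poly, of i j] triangle[OF poly poly, of j i] by auto
    qed
  qed
  thus ?thesis by (rule Cauchy_convergent)
qed

text \<open>Existence of the limit comes from the Cauchy property, independence of the approximating
  sequence from \<open>approximates_norm_diff\<close>; together they show that THE in
  \<open>completion_norm\<close> denotes that limit.\<close>

lemma approximates_norm_tendsto:
  assumes P: "approximates N P f"
  shows "(\<lambda>k. N (P k)) \<longlonglongrightarrow> completion_norm N f"
proof -
  obtain L where L: "(\<lambda>k. N (P k)) \<longlonglongrightarrow> L"
    using approximates_norm_convergent[OF P] by (auto simp: convergent_def)
  have all: "(\<lambda>k. N (P' k)) \<longlonglongrightarrow> L" if "approximates N P' f" for P'
    using tendsto_diff[OF L approximates_norm_diff[OF P that]] by simp
  have "completion_norm N f = L"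
    unfolding completion_norm_def
  proof (rule the_equality)
    show "\<forall>P. approximates N P f \<longrightarrow> (\<lambda>k. N (P k)) \<longlonglongrightarrow> L" using all by blast
    show "L' = L" if "\<forall>P. approximates N P f \<longrightarrow> (\<lambda>k. N (P k)) \<longlonglongrightarrow> L'" for L'
      using that P L LIMSEQ_unique by blast
  qed
  with L show ?thesis by simp
qed

lemma approximates_const:
  assumes "dirichlet_polynomial f"
  shows "approximates N (\<lambda>_. f) f"
proof -
  have "N (\<lambda>n. 0) \<le> 0" using le_sum[of "\<lambda>n. 0"] by (simp add: dirichlet_polynomial_def)
  hence "N (\<lambda>n. f n - f n) < \<epsilon>" if "\<epsilon> > 0" for \<epsilon> using that by simp
  thus ?thesis using assms unfolding approximates_def by auto
qed

lemma completion_norm_polynomial: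
  assumes "dirichlet_polynomial f"
  shows "completion_norm N f = N f"
  using approximates_norm_tendsto[OF approximates_const[OF assms]] LIMSEQ_unique tendsto_const by blast

lemma polynomial_in_completion_space: "dirichlet_polynomial f \<Longrightarrow> f \<in> completion_space N"
  unfolding completion_space_def using approximates_const by blast

end

text \<open>Multiplying coefficients commutes with coefficientwise limits, so an estimate on
  polynomials gives both membership and the norm bound. It serves \<open>int_op\<close> and, with m
  = 1, the identity.\<close>

lemma completion_multiplier:
  assumes "dirichlet_norm N\<^sub>1 w\<^sub>1" and "dirichlet_norm N\<^sub>2 w\<^sub>2" and C: "C > 0"
    and bound: "\<And>a. dirichlet_polynomial a \<Longrightarrow> N\<^sub>2 (\<lambda>n. m n * a n) \<le> C * N\<^sub>1 a"
    and f: "f \<in> completion_space N\<^sub>1"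
  shows "(\<lambda>n. m n * f n) \<in> completion_space N\<^sub>2"
    and "completion_norm N\<^sub>2 (\<lambda>n. m n * f n) \<le> C * completion_norm N\<^sub>1 f"
proof -
  interpret N\<^sub>1: dirichlet_norm N\<^sub>1 w\<^sub>1 by fact
  interpret N\<^sub>2: dirichlet_norm N\<^sub>2 w\<^sub>2 by fact
  obtain P where P: "approximates N\<^sub>1 P f" using f by (auto simp: completion_space_def)
  hence poly: "dirichlet_polynomial (P k)" for k by (auto simp: approximates_def)
  have mP: "approximates N\<^sub>2 (\<lambda>k n. m n * P k n) (\<lambda>n. m n * f n)"
    unfolding approximates_def
  proof (intro conjI allI impI)
    show "dirichlet_polynomial (\<lambda>n. m n * P k n)" for k by (rule dirichlet_polynomial_mult[OF poly])
    show "(\<lambda>k. m n * P k n) \<longlonglongrightarrow> m n * f n" for n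
      using P by (intro tendsto_mult_left) (auto simp: approximates_def)
    fix \<epsilon> :: real assume "\<epsilon> > 0"
    hence "\<epsilon> / C > 0" using C by simp
    then obtain K where K: "\<forall>i\<ge>K. \<forall>j\<ge>K. N\<^sub>1 (\<lambda>n. P i n - P j n) < \<epsilon> / C"
      using P unfolding approximates_def by blast
    show "\<exists>K. \<forall>i\<ge>K. \<forall>j\<ge>K. N\<^sub>2 (\<lambda>n. m n * P i n - m n * P j n) < \<epsilon>"
    proof (intro exI[of _ K] allI impI)
      fix i j assume "i \<ge> K" "j \<ge> K"
      hence "C * N\<^sub>1 (\<lambda>n. P i n - P j n) < \<epsilon>" using K C by (simp add: field_simps)
      with bound[OF dirichlet_polynomial_diff[OF poly poly], of i j]
      show "N\<^sub>2 (\<lambda>n. m n * P i n - m n * P j n) < \<epsilon>" by (simp add: right_diff_distrib)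
    qed
  qed
  thus "(\<lambda>n. m n * f n) \<in> completion_space N\<^sub>2" by (auto simp: completion_space_def)
  show "completion_norm N\<^sub>2 (\<lambda>n. m n * f n) \<le> C * completion_norm N\<^sub>1 f"
    using N\<^sub>2.approximates_norm_tendsto[OF mP] tendsto_mult_left[OF N\<^sub>1.approximates_norm_tendsto[OF P], of C]
    by (rule LIMSEQ_le) (use bound[OF poly] in auto)
qed

section \<open>Bergman norms\<close>

text \<open>The Gaussian in \<open>ln n\<close> equals n^(- \<delta>^2 * ln n / 2), which decays
  faster than every power of n.\<close>

lemma summable_gaussian_weight:
  assumes "\<delta> > 0" "q > 0" "\<kappa> > 0"
  shows "summable (\<lambda>n. exp (- (\<delta> * ln (real n))\<^sup>2 / 2) * ((2 + q * ln (real n)) / 2) powr \<kappa>)"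
proof (rule summable_comparison_test_bigo)
  show "summable (\<lambda>n. norm (real n powr - 2))" by (simp add: summable_real_powr_iff)
  show "(\<lambda>n. exp (- (\<delta> * ln (real n))\<^sup>2 / 2) * ((2 + q * ln (real n)) / 2) powr \<kappa>) \<in> O(\<lambda>n. real n powr - 2)"
    using assms by real_asymp
qed

lemma hardy_dirichlet_norm:
  assumes "q \<ge> 1"
  shows "dirichlet_norm (hardy_poly_norm q) (\<lambda>_. 1)"
proof
  show "hardy_poly_norm q (\<lambda>n. of_real (exp (- (\<delta> * ln (real n))\<^sup>2 / 2)) * a n) \<le> hardy_poly_norm q a"
    if "dirichlet_polynomial a" for a \<delta>
    using hardy_poly_norm_multiplier[OF assms dirichlet_multiplier_gaussian[of UNIV \<delta> 0] _ that] by simp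
  show "summable (\<lambda>n. exp (- (\<delta> * ln (real n))\<^sup>2 / 2) * 1)" if "\<delta> > 0" for \<delta>
  proof (rule summable_comparison_test_bigo)
    show "summable (\<lambda>n. norm (real n powr - 2))" by (simp add: summable_real_powr_iff)
    show "(\<lambda>n. exp (- (\<delta> * ln (real n))\<^sup>2 / 2) * 1) \<in> O(\<lambda>n. real n powr - 2)"
      using that by real_asymp
  qed
qed (use assms in \<open>auto simp: hardy_poly_norm_nonneg norm_coefficient_le_hardy_poly_norm
    intro: hardy_poly_norm_le_sum hardy_poly_norm_diff\<close>)

lemma sets_weight_measure [measurable_cong, simp]: "sets (weight_measure \<beta>) = sets borel"
  by (simp add: weight_measure_def)

text \<open>The Laplace transform of the weight, a Gamma integral with rate 2 + c. The value c = 0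
  gives total mass 1, and c = q * ln n the q-th power of the Bergman norm of n^(-s).\<close>

lemma has_bochner_integral_weight_measure_exp:
  assumes \<beta>: "\<beta> > -1" and c: "c \<ge> 0"
  shows "has_bochner_integral (weight_measure \<beta>) (\<lambda>\<sigma>. exp (- c * \<sigma>)) ((2 / (2 + c)) powr (\<beta> + 1))"
  unfolding weight_measure_def
proof (rule has_bochner_integral_density)
  have G: "Gamma (\<beta> + 1) > 0" using \<beta> by (intro Gamma_real_pos) simp
  show "AE \<sigma> in lborel. 0 \<le> indicator {0<..} \<sigma> * (2 powr (\<beta> + 1) / Gamma (\<beta> + 1) * \<sigma> powr \<beta> * exp (- 2 * \<sigma>))"
    using G by (intro AE_I2) auto
  have "has_bochner_integral lborel
      (\<lambda>\<sigma>. 2 powr (\<beta> + 1) / Gamma (\<beta> + 1) * (indicator {0<..} \<sigma> * (\<sigma> powr (\<beta> + 1 - 1) * exp (- (2 + c) * \<sigma>))))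
      (2 powr (\<beta> + 1) / Gamma (\<beta> + 1) * (Gamma (\<beta> + 1) / (2 + c) powr (\<beta> + 1)))"
    using \<beta> c by (intro has_bochner_integral_mult_right has_bochner_integral_powr_exp) auto
  also have "2 powr (\<beta> + 1) / Gamma (\<beta> + 1) * (Gamma (\<beta> + 1) / (2 + c) powr (\<beta> + 1)) = (2 / (2 + c)) powr (\<beta> + 1)"
    using G c by (simp add: powr_divide)
  also have "(\<lambda>\<sigma>. 2 powr (\<beta> + 1) / Gamma (\<beta> + 1) * (indicator {0<..} \<sigma> * (\<sigma> powr (\<beta> + 1 - 1) * exp (- (2 + c) * \<sigma>)))) =
     (\<lambda>\<sigma>. (indicator {0<..} \<sigma> * (2 powr (\<beta> + 1) / Gamma (\<beta> + 1) * \<sigma> powr \<beta> * exp (- 2 * \<sigma>))) *\<^sub>R exp (- c * \<sigma>))"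
  proof
    fix \<sigma>
    have "exp (- (2 + c) * \<sigma>) = exp (- 2 * \<sigma>) * exp (- c * \<sigma>)"
      by (simp add: algebra_simps flip: exp_add)
    thus "2 powr (\<beta> + 1) / Gamma (\<beta> + 1) * (indicator {0<..} \<sigma> * (\<sigma> powr (\<beta> + 1 - 1) * exp (- (2 + c) * \<sigma>))) =
      (indicator {0<..} \<sigma> * (2 powr (\<beta> + 1) / Gamma (\<beta> + 1) * \<sigma> powr \<beta> * exp (- 2 * \<sigma>))) *\<^sub>R exp (- c * \<sigma>)"
      by (simp only: mult_ac real_scaleR_def add_diff_cancel_right')
  qed
  finally show "has_bochner_integral lborel (\<lambda>\<sigma>. (indicator {0<..} \<sigma> * (2 powr (\<beta> + 1) / Gamma (\<beta> + 1) * \<sigma> powr \<beta> * exp (- 2 * \<sigma>))) *\<^sub>R exp (- c * \<sigma>))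
     ((2 / (2 + c)) powr (\<beta> + 1))" .
qed auto

lemma prob_space_weight_measure:
  assumes "\<beta> > -1"
  shows "prob_space (weight_measure \<beta>)"
proof
  have one: "has_bochner_integral (weight_measure \<beta>) (\<lambda>_. 1::real) 1"
    using has_bochner_integral_weight_measure_exp[OF assms, of 0] by simp
  have "emeasure (weight_measure \<beta>) (space (weight_measure \<beta>)) = (\<integral>\<^sup>+_. ennreal 1 \<partial>weight_measure \<beta>)" by simp
  also have "\<dots> = ennreal 1"
    using one by (subst nn_integral_eq_integral) (auto simp: has_bochner_integral_iff)
  finally show "emeasure (weight_measure \<beta>) (space (weight_measure \<beta>)) = 1" by simp
qed

lemma AE_weight_measure_pos: "AE \<sigma> in weight_measure \<beta>. \<sigma> > 0"
  unfolding weight_measure_def by (subst AE_density) (auto simp: indicator_def)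

lemma dirichlet_polynomial_shift:
  "dirichlet_polynomial a \<Longrightarrow> dirichlet_polynomial (dirichlet_shift \<sigma> a)"
  unfolding dirichlet_shift_def using dirichlet_polynomial_mult[of a "\<lambda>n. of_real (real n powr - \<sigma>)"]
  by (simp add: mult.commute)

lemma dirichlet_polynomial_support: "dirichlet_polynomial a \<Longrightarrow> a n \<noteq> 0 \<Longrightarrow> n \<ge> 1"
  by (cases n) (auto simp: dirichlet_polynomial_def)

lemma hardy_poly_norm_shift_le:
  assumes "q \<ge> 1" "dirichlet_polynomial a" "\<sigma> \<ge> 0"
  shows "hardy_poly_norm q (dirichlet_shift \<sigma> a) \<le> hardy_poly_norm q a"
  using hardy_poly_norm_multiplier[OF assms(1) dirichlet_multiplier_shift[OF order_refl assms(3)] _ assms(2)]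
    dirichlet_polynomial_support[OF assms(2)]
  by (simp add: dirichlet_shift_def mult.commute)

text \<open>Supplies measurability of the integrand in the Bergman norm. The change of the norm is
  dominated by a finite sum of changes of coefficients.\<close>

lemma continuous_hardy_poly_norm_shift:
  assumes q: "q \<ge> 1" and a: "dirichlet_polynomial a"
  shows "continuous_on UNIV (\<lambda>\<sigma>. hardy_poly_norm q (dirichlet_shift \<sigma> a))"
proof (rule continuous_at_imp_continuous_on, rule ballI)
  interpret dirichlet_norm "hardy_poly_norm q" "\<lambda>_. 1" by (rule hardy_dirichlet_norm[OF q])
  fix \<sigma> :: real
  let ?h = "\<lambda>\<sigma>. hardy_poly_norm q (dirichlet_shift \<sigma> a)"
  let ?d = "\<lambda>\<tau>. \<Sum>n | a n \<noteq> 0. cmod (a n) * \<bar>real n powr - \<tau> - real n powr - \<sigma>\<bar>"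
  have fin: "finite {n. a n \<noteq> 0}" using a by (simp add: dirichlet_polynomial_def)
  have d: "hardy_poly_norm q (\<lambda>n. dirichlet_shift \<tau> a n - dirichlet_shift \<tau>' a n)
      \<le> (\<Sum>n | a n \<noteq> 0. cmod (a n) * \<bar>real n powr - \<tau> - real n powr - \<tau>'\<bar>)" for \<tau> \<tau>'
  proof -
    have "hardy_poly_norm q (\<lambda>n. dirichlet_shift \<tau> a n - dirichlet_shift \<tau>' a n)
      \<le> (\<Sum>n | a n \<noteq> 0. cmod (dirichlet_shift \<tau> a n - dirichlet_shift \<tau>' a n))"
      by (rule le_sum_superset[OF dirichlet_polynomial_diff[OF dirichlet_polynomial_shift dirichlet_polynomial_shift] fin])
         (auto simp: a dirichlet_shift_def)
    also have "\<dots> = (\<Sum>n | a n \<noteq> 0. cmod (a n) * \<bar>real n powr - \<tau> - real n powr - \<tau>'\<bar>)"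
    proof (rule sum.cong)
      fix n
      have "dirichlet_shift \<tau> a n - dirichlet_shift \<tau>' a n = a n * of_real (real n powr - \<tau> - real n powr - \<tau>')"
        by (simp add: dirichlet_shift_def right_diff_distrib)
      thus "cmod (dirichlet_shift \<tau> a n - dirichlet_shift \<tau>' a n) = cmod (a n) * \<bar>real n powr - \<tau> - real n powr - \<tau>'\<bar>"
        by (simp only: norm_mult norm_of_real)
    qed simp
    finally show ?thesis .
  qed
  have h_le: "?h \<tau> \<le> (\<Sum>n | a n \<noteq> 0. cmod (a n) * \<bar>real n powr - \<tau> - real n powr - \<tau>'\<bar>) + ?h \<tau>'" for \<tau> \<tau>'
    using triangle[OF dirichlet_polynomial_shift[OF a] dirichlet_polynomial_shift[OF a], of \<tau> \<tau>'] d[of \<tau> \<tau>']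
    by linarith
  have "norm (?h \<tau> - ?h \<sigma>) \<le> ?d \<tau>" for \<tau>
  proof -
    have "?h \<sigma> \<le> ?d \<tau> + ?h \<tau>"
      using h_le[of \<sigma> \<tau>] by (subst (asm) abs_minus_commute)
    thus ?thesis using h_le[of \<tau> \<sigma>] unfolding real_norm_def by linarith
  qed
  moreover have "(?d \<longlongrightarrow> (\<Sum>n | a n \<noteq> 0. cmod (a n) * \<bar>real n powr - \<sigma> - real n powr - \<sigma>\<bar>)) (at \<sigma>)"
  proof (intro tendsto_sum tendsto_mult tendsto_const tendsto_rabs tendsto_diff)
    fix n assume "n \<in> {n. a n \<noteq> 0}"
    hence "n \<ge> 1" using dirichlet_polynomial_support[OF a, of n] by auto
    thus "((\<lambda>\<tau>. real n powr - \<tau>) \<longlongrightarrow> real n powr - \<sigma>) (at \<sigma>)"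
      by (intro tendsto_intros) auto
  qed
  hence "(?d \<longlongrightarrow> 0) (at \<sigma>)" by simp
  ultimately have "((\<lambda>\<tau>. ?h \<tau> - ?h \<sigma>) \<longlongrightarrow> 0) (at \<sigma>)"
    by (rule Lim_null_comparison[OF always_eventually[OF allI]])
  thus "isCont ?h \<sigma>" unfolding isCont_def by (rule LIM_zero_cancel)
qed

lemma measurable_hardy_poly_norm_shift:
  assumes "q \<ge> 1" "dirichlet_polynomial a"
  shows "(\<lambda>\<sigma>. hardy_poly_norm q (dirichlet_shift \<sigma> a)) \<in> borel_measurable (weight_measure \<beta>)"
  using borel_measurable_continuous_onI[OF continuous_hardy_poly_norm_shift[OF assms]] by simp

lemma integrable_hardy_poly_norm_shift:
  assumes q: "q \<ge> 1" and \<beta>: "\<beta> > -1" and a: "dirichlet_polynomial a"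
  shows "integrable (weight_measure \<beta>) (\<lambda>\<sigma>. hardy_poly_norm q (dirichlet_shift \<sigma> a) powr q)"
proof -
  interpret prob_space "weight_measure \<beta>" by (rule prob_space_weight_measure[OF \<beta>])
  note [measurable] = measurable_hardy_poly_norm_shift[OF q a]
  show ?thesis
  proof (rule integrable_const_bound[where B = "hardy_poly_norm q a powr q"])
    show "AE \<sigma> in weight_measure \<beta>. norm (hardy_poly_norm q (dirichlet_shift \<sigma> a) powr q) \<le> hardy_poly_norm q a powr q"
      using AE_weight_measure_pos
      by eventually_elim (use q a in \<open>auto intro!: powr_mono2 hardy_poly_norm_shift_le simp: hardy_poly_norm_nonneg\<close>)
  qed measurable
qed

lemma bergman_poly_norm_le:
  assumes q: "q \<ge> 1" and \<beta>: "\<beta> > -1" and ab: "dirichlet_polynomial a" "dirichlet_polynomial b" and C: "C \<ge> 0"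
    and le: "\<And>\<sigma>. \<sigma> > 0 \<Longrightarrow> hardy_poly_norm q (dirichlet_shift \<sigma> a) \<le> C * hardy_poly_norm q (dirichlet_shift \<sigma> b)"
  shows "bergman_poly_norm q \<beta> a \<le> C * bergman_poly_norm q \<beta> b"
proof -
  let ?I = "\<integral>\<sigma>. hardy_poly_norm q (dirichlet_shift \<sigma> b) powr q \<partial>weight_measure \<beta>"
  have "(\<integral>\<sigma>. hardy_poly_norm q (dirichlet_shift \<sigma> a) powr q \<partial>weight_measure \<beta>) \<le>
      (\<integral>\<sigma>. C powr q * hardy_poly_norm q (dirichlet_shift \<sigma> b) powr q \<partial>weight_measure \<beta>)"
  proof (rule integral_mono_AE)
    show "AE \<sigma> in weight_measure \<beta>. hardy_poly_norm q (dirichlet_shift \<sigma> a) powr q \<le>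
        C powr q * hardy_poly_norm q (dirichlet_shift \<sigma> b) powr q"
      using AE_weight_measure_pos
    proof eventually_elim
      case (elim \<sigma>)
      have "hardy_poly_norm q (dirichlet_shift \<sigma> a) powr q \<le> (C * hardy_poly_norm q (dirichlet_shift \<sigma> b)) powr q"
        using le[OF elim] q by (intro powr_mono2) (auto simp: hardy_poly_norm_nonneg)
      thus ?case using C by (simp add: powr_mult hardy_poly_norm_nonneg)
    qed
  qed (use integrable_hardy_poly_norm_shift[OF q \<beta>] ab in auto)
  hence "bergman_poly_norm q \<beta> a \<le> (C powr q * ?I) powr (1 / q)"
    unfolding bergman_poly_norm_def using q by (intro powr_mono2) auto
  also have "\<dots> = C * ?I powr (1 / q)" using q C by (simp add: powr_mult powr_powr)
  finally show ?thesis by (simp add: bergman_poly_norm_def)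
qed

lemma bergman_poly_norm_multiplier:
  assumes q: "q \<ge> 1" and \<beta>: "\<beta> > -1" and mult: "dirichlet_multiplier A m C" and C: "C > 0"
    and a: "dirichlet_polynomial a" "\<And>n. a n \<noteq> 0 \<Longrightarrow> n \<in> A"
  shows "bergman_poly_norm q \<beta> (\<lambda>n. m n * a n) \<le> C * bergman_poly_norm q \<beta> a"
proof (rule bergman_poly_norm_le[OF q \<beta>])
  fix \<sigma> :: real
  have "dirichlet_shift \<sigma> (\<lambda>n. m n * a n) = (\<lambda>n. m n * dirichlet_shift \<sigma> a n)"
    by (simp add: dirichlet_shift_def mult.assoc)
  thus "hardy_poly_norm q (dirichlet_shift \<sigma> (\<lambda>n. m n * a n)) \<le> C * hardy_poly_norm q (dirichlet_shift \<sigma> a)"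
    using hardy_poly_norm_multiplier[OF q mult C dirichlet_polynomial_shift[OF a(1)], of \<sigma>] a(2)
    by (simp add: dirichlet_shift_def)
qed (use a C in \<open>auto intro: dirichlet_polynomial_mult\<close>)

text \<open>Shifts contract the Hardy norm, and the weight is a probability measure.\<close>

lemma bergman_poly_norm_le_hardy_poly_norm:
  assumes q: "q \<ge> 1" and \<beta>: "\<beta> > -1" and a: "dirichlet_polynomial a"
  shows "bergman_poly_norm q \<beta> a \<le> hardy_poly_norm q a"
proof -
  interpret prob_space "weight_measure \<beta>" by (rule prob_space_weight_measure[OF \<beta>])
  have "(\<integral>\<sigma>. hardy_poly_norm q (dirichlet_shift \<sigma> a) powr q \<partial>weight_measure \<beta>) \<le>
      (\<integral>\<sigma>. hardy_poly_norm q a powr q \<partial>weight_measure \<beta>)"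
  proof (rule integral_mono_AE)
    show "AE \<sigma> in weight_measure \<beta>. hardy_poly_norm q (dirichlet_shift \<sigma> a) powr q \<le> hardy_poly_norm q a powr q"
      using AE_weight_measure_pos
      by eventually_elim (use q a in \<open>auto intro!: powr_mono2 hardy_poly_norm_shift_le simp: hardy_poly_norm_nonneg\<close>)
  qed (use integrable_hardy_poly_norm_shift[OF q \<beta> a] in auto)
  hence "bergman_poly_norm q \<beta> a \<le> (hardy_poly_norm q a powr q) powr (1 / q)"
    unfolding bergman_poly_norm_def using q by (intro powr_mono2) (auto simp: prob_space)
  thus ?thesis using q by (simp add: powr_powr hardy_poly_norm_nonneg)
qed

text \<open>Averaging an exponential lower bound costs the Laplace transform of the weight at q * c,
  a power of 2 + q * c. It is applied with c = ln n to one coefficient and with c = ln N to a whole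
  polynomial.\<close>

lemma bergman_poly_norm_ge_exp:
  assumes q: "q \<ge> 1" and \<beta>: "\<beta> > -1" and a: "dirichlet_polynomial a" and L: "L \<ge> 0" and c: "c \<ge> 0"
    and ge: "\<And>\<sigma>. \<sigma> > 0 \<Longrightarrow> L * exp (- c * \<sigma>) \<le> hardy_poly_norm q (dirichlet_shift \<sigma> a)"
  shows "L \<le> ((2 + q * c) / 2) powr ((\<beta> + 1) / q) * bergman_poly_norm q \<beta> a"
proof -
  let ?I = "\<integral>\<sigma>. hardy_poly_norm q (dirichlet_shift \<sigma> a) powr q \<partial>weight_measure \<beta>"
  have exp: "has_bochner_integral (weight_measure \<beta>) (\<lambda>\<sigma>. L powr q * exp (- (q * c) * \<sigma>))
      (L powr q * (2 / (2 + q * c)) powr (\<beta> + 1))"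
    using q c by (intro has_bochner_integral_mult_right has_bochner_integral_weight_measure_exp[OF \<beta>]) auto
  have qc: "2 + q * c > 0" using q c by (intro add_pos_nonneg) auto
  have "L powr q * (2 / (2 + q * c)) powr (\<beta> + 1) = (\<integral>\<sigma>. L powr q * exp (- (q * c) * \<sigma>) \<partial>weight_measure \<beta>)"
    using has_bochner_integral_integral_eq[OF exp] ..
  also have "\<dots> \<le> ?I"
  proof (rule integral_mono_AE)
    show "AE \<sigma> in weight_measure \<beta>. L powr q * exp (- (q * c) * \<sigma>) \<le> hardy_poly_norm q (dirichlet_shift \<sigma> a) powr q"
      using AE_weight_measure_pos
    proof eventually_elim
      case (elim \<sigma>)
      have "L powr q * exp (- (q * c) * \<sigma>) = (L * exp (- c * \<sigma>)) powr q"
        using L by (simp add: powr_mult powr_def[of "exp _"] mult_ac)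
      also have "\<dots> \<le> hardy_poly_norm q (dirichlet_shift \<sigma> a) powr q"
        using ge[OF elim] L q by (intro powr_mono2) auto
      finally show ?case .
    qed
  qed (use exp integrable_hardy_poly_norm_shift[OF q \<beta> a] in \<open>auto simp: has_bochner_integral_iff\<close>)
  finally have "(L powr q * (2 / (2 + q * c)) powr (\<beta> + 1)) powr (1 / q) \<le> bergman_poly_norm q \<beta> a"
    unfolding bergman_poly_norm_def using q by (intro powr_mono2) auto
  moreover have "(L powr q * (2 / (2 + q * c)) powr (\<beta> + 1)) powr (1 / q) = L * (2 / (2 + q * c)) powr ((\<beta> + 1) / q)"
    using L q qc by (simp add: powr_mult powr_powr)
  moreover have "((2 + q * c) / 2) powr ((\<beta> + 1) / q) * (2 / (2 + q * c)) powr ((\<beta> + 1) / q) = 1"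
  proof -
    have "y / 2 * (2 / y) = 1" if "y > 0" for y :: real using that by simp
    from this[OF qc] show ?thesis unfolding powr_mult[symmetric] by (simp only: powr_one_eq_one)
  qed
  hence "L = ((2 + q * c) / 2) powr ((\<beta> + 1) / q) * (L * (2 / (2 + q * c)) powr ((\<beta> + 1) / q))"
    by (simp add: mult_ac)
  ultimately show ?thesis by (smt (verit) mult_left_mono powr_ge_zero)
qed

text \<open>For n >= 1 the coefficient weight is the reciprocal of the Bergman norm of n^(-s); it
  grows only like a power of \<open>ln n\<close>.\<close>

lemma bergman_dirichlet_norm:
  assumes q: "q \<ge> 1" and \<beta>: "\<beta> > -1"
  shows "dirichlet_norm (bergman_poly_norm q \<beta>) (\<lambda>n. ((2 + q * ln (real n)) / 2) powr ((\<beta> + 1) / q))"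
proof
  fix a b :: "nat \<Rightarrow> complex" and \<delta> :: real
  assume a: "dirichlet_polynomial a"
  show "0 \<le> bergman_poly_norm q \<beta> a" by (simp add: bergman_poly_norm_def)
  show "bergman_poly_norm q \<beta> a \<le> (\<Sum>n | a n \<noteq> 0. cmod (a n))"
    using bergman_poly_norm_le_hardy_poly_norm[OF q \<beta> a] hardy_poly_norm_le_sum[of q a] q by simp
  show "bergman_poly_norm q \<beta> (\<lambda>n. of_real (exp (- (\<delta> * ln (real n))\<^sup>2 / 2)) * a n) \<le> bergman_poly_norm q \<beta> a"
    using bergman_poly_norm_multiplier[OF q \<beta> dirichlet_multiplier_gaussian[of UNIV \<delta> 0] _ a] by simp
  show "bergman_poly_norm q \<beta> (\<lambda>n. a n - b n) \<le> bergman_poly_norm q \<beta> a + bergman_poly_norm q \<beta> b"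
    if b: "dirichlet_polynomial b"
    unfolding bergman_poly_norm_def
  proof (rule minkowski_integral[OF q])
    fix \<sigma>
    have "dirichlet_shift \<sigma> (\<lambda>n. a n - b n) = (\<lambda>n. dirichlet_shift \<sigma> a n - dirichlet_shift \<sigma> b n)"
      by (simp add: dirichlet_shift_def left_diff_distrib)
    thus "hardy_poly_norm q (dirichlet_shift \<sigma> (\<lambda>n. a n - b n)) \<le>
        hardy_poly_norm q (dirichlet_shift \<sigma> a) + hardy_poly_norm q (dirichlet_shift \<sigma> b)"
      using hardy_poly_norm_diff[OF q dirichlet_polynomial_shift[OF a] dirichlet_polynomial_shift[OF b], of \<sigma> \<sigma>] by simp
  qed (use a b q \<beta> in \<open>auto simp: hardy_poly_norm_nonneg
        intro: integrable_hardy_poly_norm_shift measurable_hardy_poly_norm_shift dirichlet_polynomial_diff\<close>)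
  show "cmod (a n) \<le> ((2 + q * ln (real n)) / 2) powr ((\<beta> + 1) / q) * bergman_poly_norm q \<beta> a" for n
  proof (cases "n = 0")
    case True
    thus ?thesis using a by (simp add: dirichlet_polynomial_def bergman_poly_norm_def)
  next
    case False
    show ?thesis
    proof (rule bergman_poly_norm_ge_exp[OF q \<beta> a])
      fix \<sigma> :: real
      have "cmod (a n) * exp (- ln (real n) * \<sigma>) = cmod (dirichlet_shift \<sigma> a n)"
        using False by (simp add: dirichlet_shift_def norm_mult powr_def mult.commute)
      also have "\<dots> \<le> hardy_poly_norm q (dirichlet_shift \<sigma> a)"
        by (rule norm_coefficient_le_hardy_poly_norm[OF q dirichlet_polynomial_shift[OF a]])
      finally show "cmod (a n) * exp (- ln (real n) * \<sigma>) \<le> hardy_poly_norm q (dirichlet_shift \<sigma> a)" .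
    qed (use False in auto)
  qed
next
  show "summable (\<lambda>n. exp (- (\<delta> * ln (real n))\<^sup>2 / 2) * ((2 + q * ln (real n)) / 2) powr ((\<beta> + 1) / q))"
    if "\<delta> > 0" for \<delta>
    using that q \<beta> by (intro summable_gaussian_weight) auto
qed auto

section \<open>Integration and embedding operators\<close>

lemma cmod_1_plus_cis_squared: "(cmod (1 + cis x))\<^sup>2 = 2 + 2 * cos x"
proof -
  have "(cmod (1 + cis x))\<^sup>2 = 1 + 2 * cos x + ((cos x)\<^sup>2 + (sin x)\<^sup>2)"
    unfolding cmod_power2 by (simp add: power2_eq_square algebra_simps)
  thus ?thesis by simp
qed

lemma integrable_circle_1_plus:
  assumes "r > 0"
  shows "integrable circle_measure (\<lambda>z. cmod (1 + z) powr r)"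
proof (rule circle.integrable_const_bound[where B = "2 powr r"])
  have "cmod (1 + z) \<le> 2" if "z \<in> space circle_measure" for z
    using that norm_triangle_ineq[of 1 z] by (simp add: space_circle_measure)
  thus "AE z in circle_measure. norm (cmod (1 + z) powr r) \<le> 2 powr r"
    using assms by (intro AE_I2) (auto intro: powr_mono2)
  show "(\<lambda>z. cmod (1 + z) powr r) \<in> borel_measurable circle_measure"
    unfolding measurable_cong_sets[OF sets_circle_measure refl]
    by (rule measurable_restrict_space1) measurable
qed

text \<open>An almost sure property holds somewhere on every arc, and |1 + z| is larger on an arc
  where the cosine is positive than on one where it is negative.\<close>

lemma not_AE_circle_1_plus_const:
  assumes r: "r > 0"
  shows "\<not> (AE z in circle_measure. cmod (1 + z) powr r = c)"
proof
  assume ae: "AE z in circle_measure. cmod (1 + z) powr r = c"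
  have "AE x in uniform_measure lborel {0..<2 * pi}. cmod (1 + cis x) powr r = c"
    by (rule AE_distrD[OF _ ae[unfolded circle_measure_def]]) measurable
  hence ae': "AE x in lborel. x \<in> {0..<2 * pi} \<longrightarrow> cmod (1 + cis x) powr r = c"
    by (subst (asm) AE_uniform_measure) auto
  have ex: "\<exists>x\<in>{a<..<b}. cmod (1 + cis x) powr r = c" if ab: "0 \<le> a" "a < b" "b < 2 * pi" for a b
  proof (rule ccontr)
    assume none: "\<not> ?thesis"
    have "AE x in lborel. x \<notin> {a<..<b}"
      using ae'
    proof eventually_elim
      case (elim x)
      thus ?case using none ab by auto
    qed
    hence "{a<..<b} \<in> null_sets lborel" by (subst AE_iff_null_sets) auto
    thus False using ab by (simp add: null_sets_def)
  qed
  \<comment> \<open>The intervals (0, 1) and (2, 3) lie in (0, pi), on either side of pi /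
    2.\<close>
  obtain x where x: "0 < x" "x < 1" "cmod (1 + cis x) powr r = c"
    using ex[of 0 1] pi_gt3 by auto
  obtain y where y: "2 < y" "y < 3" "cmod (1 + cis y) powr r = c"
    using ex[of 2 3] pi_gt3 by auto
  have "cos x > 0" using x pi_gt3 by (intro cos_gt_zero_pi) auto
  moreover have "cos y < 0"
  proof -
    have "cos (pi - y) > 0" using y pi_gt3 pi_less_4 by (intro cos_gt_zero_pi) auto
    thus ?thesis by simp
  qed
  ultimately have "(cmod (1 + cis y))\<^sup>2 < (cmod (1 + cis x))\<^sup>2" by (simp add: cmod_1_plus_cis_squared)
  hence "cmod (1 + cis y) < cmod (1 + cis x)" by (rule power2_less_imp_less) simp
  hence "cmod (1 + cis y) powr r < cmod (1 + cis x) powr r" using r by (intro powr_less_mono2) auto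
  thus False using x y by simp
qed

definition circle_norm_1_plus :: "real \<Rightarrow> real" where
  "circle_norm_1_plus r = (\<integral>z. cmod (1 + z) powr r \<partial>circle_measure) powr (1 / r)"

text \<open>Equality in Lyapunov's inequality would force |1 + z| to be almost surely constant. The
  strict quotient is the base of the exponential growth.\<close>

lemma circle_norm_1_plus_strict_mono:
  assumes "1 \<le> p" "p < q"
  shows "circle_norm_1_plus p < circle_norm_1_plus q"
proof -
  note int = integrable_circle_1_plus
  have "circle_norm_1_plus p \<le> circle_norm_1_plus q"
    unfolding circle_norm_1_plus_def
    by (rule circle.lyapunov_inequality(1)) (use assms int in auto)
  moreover have "circle_norm_1_plus p \<noteq> circle_norm_1_plus q"
  proof
    assume eq: "circle_norm_1_plus p = circle_norm_1_plus q"
    have "AE z in circle_measure. cmod (1 + z) powr p = (\<integral>z. cmod (1 + z) powr p \<partial>circle_measure)"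
      by (rule circle.lyapunov_inequality(2)[OF assms _ _ _ eq[unfolded circle_norm_1_plus_def]])
         (use assms int in auto)
    thus False using not_AE_circle_1_plus_const[of p] assms by auto
  qed
  ultimately show ?thesis by simp
qed

text \<open>
  The factor \<open>2 powr (- s)\<close>, unimodular on the torus, makes the first coefficient vanish without
  changing any norm.
\<close>

definition prime_product_series :: "nat set \<Rightarrow> nat \<Rightarrow> complex" where
  "prime_product_series A n = (if n \<in> (\<lambda>B. 2 * \<Prod>B) ` Pow A then 1 else 0)"

lemma torus_lift_prime_product_series:
  assumes A: "finite A" "A \<subseteq> {p. prime p}"
  shows "torus_lift (prime_product_series A) z = z 2 * (\<Prod>p\<in>A. 1 + z p)"
proof -
  have fin: "finite B" and pr: "B \<subseteq> {p. prime p}" if "B \<in> Pow A" for B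
    using that A by (auto intro: finite_subset)
  have pos: "\<Prod>B > 0" if "B \<in> Pow A" for B
    using pr[OF that] by (intro prod_pos) (auto simp: prime_gt_0_nat)
  \<comment> \<open>A set of primes is recovered from its product. The leading factor 2 is left
    aside here because 2 may itself belong to A.\<close>
  have factors: "prime_factors (\<Prod>B) = B" if B: "B \<in> Pow A" for B
  proof (intro set_eqI iffI)
    fix p assume "p \<in> prime_factors (\<Prod>B)"
    hence p: "prime p" "p dvd \<Prod>B" by (auto simp: in_prime_factors_iff)
    then obtain r where r: "r \<in> B" "p dvd r"
      using prime_dvd_prod_iff[OF fin[OF B] p(1), of "\<lambda>x. x"] by auto
    hence "p = r" using pr[OF B] p(1) primes_dvd_imp_eq by blast
    thus "p \<in> B" using r by simp
  next
    fix p assume p: "p \<in> B"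
    hence "p dvd \<Prod>B" using dvd_prodI[OF fin[OF B] p, of "\<lambda>x. x"] by simp
    thus "p \<in> prime_factors (\<Prod>B)" using p pr[OF B] pos[OF B] by (auto simp: in_prime_factors_iff)
  qed
  have inj: "inj_on (\<lambda>B. 2 * \<Prod>B) (Pow A)"
    by (rule inj_onI) (metis factors mult_left_cancel zero_neq_numeral)
  have "torus_lift (prime_product_series A) z = (\<Sum>n\<in>(\<lambda>B. 2 * \<Prod>B) ` Pow A. prime_product_series A n * torus_char z n)"
    by (rule torus_lift_eq_sum) (use A in \<open>auto simp: prime_product_series_def split: if_splits\<close>)
  also have "\<dots> = (\<Sum>B\<in>Pow A. torus_char z (2 * \<Prod>B))"
    by (subst sum.reindex[OF inj]) (auto simp: prime_product_series_def intro!: sum.cong)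
  also have "\<dots> = (\<Sum>B\<in>Pow A. z 2 * (\<Prod>p\<in>B. z p))"
    using pos fin pr by (intro sum.cong refl) (simp add: torus_char_mult torus_char_prime torus_char_prod_primes)
  also have "\<dots> = z 2 * (\<Sum>B\<in>Pow A. (\<Prod>p\<in>B. z p) * (\<Prod>p\<in>A - B. 1))"
    by (simp add: sum_distrib_left)
  also have "(\<Sum>B\<in>Pow A. (\<Prod>p\<in>B. z p) * (\<Prod>p\<in>A - B. 1)) = (\<Prod>p\<in>A. z p + 1)"
    by (rule prod_add[OF A(1), symmetric])
  finally show ?thesis by (simp add: add.commute)
qed

lemma hardy_poly_norm_prime_product_series:
  assumes A: "finite A" "A \<subseteq> {p. prime p}" and r: "r > 0"
  shows "hardy_poly_norm r (prime_product_series A) = circle_norm_1_plus r ^ card A"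
proof -
  let ?I = "\<integral>z. cmod (1 + z) powr r \<partial>circle_measure"
  have "(\<integral>z. cmod (torus_lift (prime_product_series A) z) powr r \<partial>torus_measure) =
      (\<integral>z. (\<Prod>p\<in>A. cmod (1 + z p) powr r) \<partial>torus_measure)"
    by (intro Bochner_Integration.integral_cong)
       (auto simp: torus_lift_prime_product_series[OF A] norm_mult norm_torus_component prod_norm[symmetric]
          prod_powr_distrib)
  also have "\<dots> = ?I ^ card A"
    by (rule integral_torus_prod[OF A integrable_circle_1_plus[OF r]])
  finally have "hardy_poly_norm r (prime_product_series A) = (?I ^ card A) powr (1 / r)"
    by (simp add: hardy_poly_norm_eq)
  also have "(?I ^ k) powr (1 / r) = (?I powr (1 / r)) ^ k" for k
    by (induction k) (auto simp: powr_mult)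
  finally show ?thesis by (simp add: circle_norm_1_plus_def)
qed

text \<open>A consists of the k primes up to 4^m, and N = 2 * \<Prod>A is the largest index in the
  spectrum. Each prime adds at most m * ln 4 <= 2 * m to \<open>ln N\<close>, and m <= k by the
  prime counting bound.\<close>

lemma exists_prime_product_series:
  fixes m :: nat
  obtains f N k where "dirichlet_polynomial f" "\<And>n. f n \<noteq> 0 \<Longrightarrow> n \<in> {2..N}" "N \<ge> 2" "k \<ge> m"
    "ln (real N) \<le> 1 + 2 * (real k)\<^sup>2" "\<And>r. r > 0 \<Longrightarrow> hardy_poly_norm r f = circle_norm_1_plus r ^ k"
proof
  define A where "A = {p. prime p \<and> p \<le> (4::nat) ^ m}"
  define N where "N = 2 * \<Prod>A"
  have A: "finite A" "A \<subseteq> {p. prime p}"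
    unfolding A_def by (auto intro: finite_subset[of _ "{..4 ^ m}"])
  have pos: "\<Prod>B > 0" if "B \<subseteq> A" for B
    using that A by (intro prod_pos) (auto simp: prime_gt_0_nat)
  have supp: "n \<in> {2..N}" if n: "prime_product_series A n \<noteq> 0" for n
  proof -
    obtain B where B: "B \<subseteq> A" "n = 2 * \<Prod>B"
      using n by (auto simp: prime_product_series_def split: if_splits)
    have "\<Prod>B dvd \<Prod>A" using A B by (intro prod_dvd_prod_subset) auto
    hence "\<Prod>B \<le> \<Prod>A" using pos[of A] by (intro dvd_imp_le) auto
    thus ?thesis using B pos[OF B(1)] by (auto simp: N_def)
  qed
  show "n \<in> {2..N}" if "prime_product_series A n \<noteq> 0" for n by (rule supp[OF that])
  show "dirichlet_polynomial (prime_product_series A)"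
  proof -
    have "{n. prime_product_series A n \<noteq> 0} \<subseteq> {2..N}" using supp by auto
    moreover have "prime_product_series A 0 = 0" using supp[of 0] by fastforce
    ultimately show ?thesis by (auto simp: dirichlet_polynomial_def intro: finite_subset)
  qed
  show "N \<ge> 2" using pos[of A] by (simp add: N_def)
  show card: "card A \<ge> m" using prime_counting_lower_bound[of m] by (simp add: A_def)
  have ln2: "ln (2::real) \<le> 1" using ln_le_minus_one[of "2::real"] by simp
  have "ln (\<Prod>p\<in>A. real p) = (\<Sum>p\<in>A. ln (real p))"
    using A prime_gt_0_nat by (intro ln_prod) auto
  moreover have "real (\<Prod>A) > 0" using pos[OF order_refl] by linarith
  hence "ln (real N) = ln 2 + ln (real (\<Prod>A))"
    unfolding N_def of_nat_mult of_nat_numeral by (intro ln_mult_pos) auto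
  ultimately have "ln (real N) = ln 2 + (\<Sum>p\<in>A. ln (real p))" by simp
  also have "(\<Sum>p\<in>A. ln (real p)) \<le> (\<Sum>p\<in>A. real m * (2 * ln 2))"
  proof (rule sum_mono)
    fix p assume p: "p \<in> A"
    hence "real p \<le> 4 ^ m" unfolding A_def by (metis (mono_tags, lifting) mem_Collect_eq of_nat_le_iff of_nat_numeral of_nat_power)
    hence "ln (real p) \<le> ln (4 ^ m)" using p A prime_gt_0_nat by auto
    also have "\<dots> = real m * (2 * ln 2)"
      using ln_realpow[of "2::real" 2] by (simp add: ln_realpow)
    finally show "ln (real p) \<le> real m * (2 * ln 2)" .
  qed
  also have "\<dots> \<le> real (card A) * (real (card A) * (2 * 1))"
    unfolding sum_constant using card ln2 by (intro mult_left_mono mult_mono) auto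
  finally show "ln (real N) \<le> 1 + 2 * (real (card A))\<^sup>2"
    using ln2 by (simp add: power2_eq_square)
  show "hardy_poly_norm r (prime_product_series A) = circle_norm_1_plus r ^ card A" if "r > 0" for r
    by (rule hardy_poly_norm_prime_product_series[OF A that])
qed

text \<open>
  The ratio of the two norms of the test functions grows exponentially in the number \<open>k\<close> of
  primes, while \<open>ln N\<close> is only quadratic in \<open>k\<close>.
\<close>

lemma no_polylogarithmic_bound:
  assumes pq: "1 \<le> p" "p < q" and C: "C \<ge> 0" and \<kappa>: "\<kappa> > 0"
  shows "\<exists>f N. dirichlet_polynomial f \<and> (\<forall>n. f n \<noteq> 0 \<longrightarrow> n \<in> {2..N}) \<and> N \<ge> 2 \<and>
    C * ln (real N) ^ M * ((2 + q * ln (real N)) / 2) powr \<kappa> * hardy_poly_norm p f < hardy_poly_norm q f"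
proof -
  let ?A = circle_norm_1_plus
  have Ap: "?A p \<ge> 0" by (simp add: circle_norm_1_plus_def)
  have Aq: "?A q > 0" using circle_norm_1_plus_strict_mono[OF pq] Ap by simp
  \<comment> \<open>The maximum with 1/2 places \<theta> strictly between 0 and 1 although the
    numerator is only known to be nonnegative.\<close>
  define \<theta> where "\<theta> = max (?A p / ?A q) (1 / 2)"
  have \<theta>: "\<theta> > 0" "\<theta> < 1" "?A p \<le> \<theta> * ?A q"
    using circle_norm_1_plus_strict_mono[OF pq] Aq by (auto simp: \<theta>_def field_simps max_def)
  have "(\<lambda>k. C * (1 + 2 * (real k)\<^sup>2) ^ M * ((2 + q * (1 + 2 * (real k)\<^sup>2)) / 2) powr \<kappa> * \<theta> ^ k) \<longlonglongrightarrow> 0"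
    using \<theta> pq \<kappa> by real_asymp
  hence "\<forall>\<^sub>F k in sequentially. C * (1 + 2 * (real k)\<^sup>2) ^ M * ((2 + q * (1 + 2 * (real k)\<^sup>2)) / 2) powr \<kappa> * \<theta> ^ k < 1"
    by (rule order_tendstoD) simp
  then obtain m where m: "C * (1 + 2 * (real k)\<^sup>2) ^ M * ((2 + q * (1 + 2 * (real k)\<^sup>2)) / 2) powr \<kappa> * \<theta> ^ k < 1"
    if "k \<ge> m" for k
    by (auto simp: eventually_sequentially)
  obtain f N k where f: "dirichlet_polynomial f" "\<And>n. f n \<noteq> 0 \<Longrightarrow> n \<in> {2..N}" "N \<ge> 2" "k \<ge> m"
    "ln (real N) \<le> 1 + 2 * (real k)\<^sup>2" "\<And>r. r > 0 \<Longrightarrow> hardy_poly_norm r f = ?A r ^ k"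
    by (rule exists_prime_product_series[of m]) (rule that; assumption)
  have lnN: "ln (real N) \<ge> 0" using f(3) by simp
  have q0: "q > 0" using pq by simp
  have "C * ln (real N) ^ M * ((2 + q * ln (real N)) / 2) powr \<kappa> * hardy_poly_norm p f \<le>
      C * (1 + 2 * (real k)\<^sup>2) ^ M * ((2 + q * (1 + 2 * (real k)\<^sup>2)) / 2) powr \<kappa> * (\<theta> * ?A q) ^ k"
  proof -
    have "((2 + q * ln (real N)) / 2) powr \<kappa> \<le> ((2 + q * (1 + 2 * (real k)\<^sup>2)) / 2) powr \<kappa>"
      using f(5) lnN q0 \<kappa> by (intro powr_mono2 divide_right_mono add_left_mono mult_left_mono) auto
    moreover have "ln (real N) ^ M \<le> (1 + 2 * (real k)\<^sup>2) ^ M"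
      using f(5) lnN by (intro power_mono)
    moreover have "hardy_poly_norm p f \<le> (\<theta> * ?A q) ^ k"
      using f(6)[of p] pq \<theta>(3) Ap by (auto intro: power_mono)
    ultimately show ?thesis
      using C lnN by (intro mult_mono) (auto simp: hardy_poly_norm_nonneg intro!: mult_nonneg_nonneg)
  qed
  also have "\<dots> = (C * (1 + 2 * (real k)\<^sup>2) ^ M * ((2 + q * (1 + 2 * (real k)\<^sup>2)) / 2) powr \<kappa> * \<theta> ^ k) * ?A q ^ k"
    by (simp add: power_mult_distrib)
  also have "\<dots> < 1 * ?A q ^ k"
    using m[OF f(4)] Aq by (intro mult_strict_right_mono) auto
  also have "\<dots> = hardy_poly_norm q f" using f(6)[of q] pq by simp
  finally show ?thesis using f by blast
qed

section \<open>Undoing shifts and integration on a finite spectrum\<close>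

text \<open>Undoing the shift by \<sigma> costs N^\<sigma>, so the shifted norm decays at most like
  exp (- ln N * \<sigma>); averaging this bound costs a power of \<open>ln N\<close>.\<close>

lemma hardy_poly_norm_le_bergman_poly_norm:
  assumes q: "q \<ge> 1" and \<beta>: "\<beta> > -1" and a: "dirichlet_polynomial a" and N: "N \<ge> 1"
    and supp: "\<And>n. a n \<noteq> 0 \<Longrightarrow> n \<le> N"
  shows "hardy_poly_norm q a \<le> ((2 + q * ln (real N)) / 2) powr ((\<beta> + 1) / q) * bergman_poly_norm q \<beta> a"
proof (rule bergman_poly_norm_ge_exp[OF q \<beta> a])
  fix \<sigma> :: real assume \<sigma>: "\<sigma> > 0"
  have "hardy_poly_norm q (\<lambda>n. of_real (real n powr \<sigma>) * dirichlet_shift \<sigma> a n) \<le>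
      real N powr \<sigma> * hardy_poly_norm q (dirichlet_shift \<sigma> a)"
  proof (rule hardy_poly_norm_multiplier[OF q dirichlet_multiplier_inverse_shift _ dirichlet_polynomial_shift[OF a]])
    fix n assume "dirichlet_shift \<sigma> a n \<noteq> 0"
    hence "a n \<noteq> 0" by (auto simp: dirichlet_shift_def)
    thus "n \<in> {1..N}" using supp dirichlet_polynomial_support[OF a] by auto
  qed (use N \<sigma> in auto)
  also have "(\<lambda>n. of_real (real n powr \<sigma>) * dirichlet_shift \<sigma> a n) = a"
  proof
    fix n show "of_real (real n powr \<sigma>) * dirichlet_shift \<sigma> a n = a n"
      using dirichlet_polynomial_support[OF a, of n]
      by (cases "a n = 0") (auto simp: dirichlet_shift_def powr_minus)
  qed
  finally show "hardy_poly_norm q a * exp (- ln (real N) * \<sigma>) \<le> hardy_poly_norm q (dirichlet_shift \<sigma> a)"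
    using N by (simp add: powr_def exp_minus field_simps)
qed (use N hardy_poly_norm_nonneg in auto)

lemma int_op_eq_multiplier:
  "int_op t a = (\<lambda>n. (if n \<ge> 2 then of_real (ln (real n) powr - t) else 0) * a n)"
  by (auto simp: int_op_def fun_eq_iff powr_minus field_simps)

lemma hardy_poly_norm_ln_power:
  assumes q: "q \<ge> 1" and a: "dirichlet_polynomial a" and N: "N \<ge> 2"
    and supp: "\<And>n. a n \<noteq> 0 \<Longrightarrow> n \<le> N"
  shows "hardy_poly_norm q (\<lambda>n. of_real (ln (real n)) ^ M * a n) \<le> (exp 1 * ln (real N)) ^ M * hardy_poly_norm q a"
proof (induction M)
  case (Suc M)
  have "hardy_poly_norm q (\<lambda>n. of_real (ln (real n)) * (of_real (ln (real n)) ^ M * a n)) \<le>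
     exp 1 * ln (real N) * hardy_poly_norm q (\<lambda>n. of_real (ln (real n)) ^ M * a n)"
  proof (rule hardy_poly_norm_multiplier[OF q dirichlet_multiplier_ln[OF N] _ dirichlet_polynomial_mult[OF a]])
    fix n assume "of_real (ln (real n)) ^ M * a n \<noteq> 0"
    thus "n \<in> {1..N}" using supp[of n] dirichlet_polynomial_support[OF a, of n] by auto
  qed (use N in auto)
  also have "\<dots> \<le> exp 1 * ln (real N) * ((exp 1 * ln (real N)) ^ M * hardy_poly_norm q a)"
    using Suc.IH N by (intro mult_left_mono) auto
  finally show ?case by (simp add: mult_ac)
qed simp

text \<open>Bernstein's inequality yields only integer powers of \<open>ln n\<close>. The power t is
  therefore overshot to an integer M, and the excess s = M - t is taken back by a bounded fractional
  integral.\<close>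

lemma hardy_poly_norm_le_int_op:
  assumes q: "q \<ge> 1" and t: "t > 0"
  obtains C M where "C > 0" "\<And>a N. dirichlet_polynomial a \<Longrightarrow> N \<ge> 2 \<Longrightarrow> (\<And>n. a n \<noteq> 0 \<Longrightarrow> n \<in> {2..N}) \<Longrightarrow>
    hardy_poly_norm q a \<le> C * ln (real N) ^ M * hardy_poly_norm q (int_op t a)"
proof
  \<comment> \<open>M exceeds t strictly even for integer t, since the fractional integral needs a
    positive order s.\<close>
  define M where "M = nat \<lceil>t\<rceil> + 1"
  have M: "real M > t" unfolding M_def by linarith
  define s where "s = real M - t"
  have s: "s > 0" using M by (simp add: s_def)
  define C where "C = exp 1 ^ M * ln 2 powr - s"
  show "C > 0" by (simp add: C_def)
  fix a :: "nat \<Rightarrow> complex" and N :: nat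
  assume a: "dirichlet_polynomial a" and N: "N \<ge> 2" and supp: "\<And>n. a n \<noteq> 0 \<Longrightarrow> n \<in> {2..N}"
  define b where "b = (\<lambda>n. of_real (ln (real n) powr - s) * int_op t a n)"
  have poly: "dirichlet_polynomial (int_op t a)"
    unfolding int_op_eq_multiplier by (rule dirichlet_polynomial_mult[OF a])
  hence poly_b: "dirichlet_polynomial b" unfolding b_def by (rule dirichlet_polynomial_mult)
  have supp': "int_op t a n \<noteq> 0 \<Longrightarrow> n \<in> {2..N}" for n
    using supp[of n] by (auto simp: int_op_def split: if_splits)
  have "(\<lambda>n. of_real (ln (real n)) ^ M * b n) = a"
  proof
    fix n show "of_real (ln (real n)) ^ M * b n = a n"
    proof (cases "a n = 0")
      case True thus ?thesis by (simp add: b_def int_op_def)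
    next
      case False
      hence n: "n \<ge> 2" using supp by auto
      hence ln: "ln (real n) > 0" by simp
      have "ln (real n) ^ M * (ln (real n) powr - s * ln (real n) powr - t) = ln (real n) powr (real M + (- s + - t))"
        by (simp only: powr_add powr_realpow[OF ln])
      also have "\<dots> = 1" using ln by (simp add: s_def)
      finally have "complex_of_real (ln (real n) ^ M * (ln (real n) powr - s * ln (real n) powr - t)) = 1" by simp
      moreover have "of_real (ln (real n)) ^ M * b n =
          complex_of_real (ln (real n) ^ M * (ln (real n) powr - s * ln (real n) powr - t)) * a n"
        by (simp only: b_def int_op_eq_multiplier if_P[OF n] of_real_mult of_real_power mult.assoc)
      ultimately show ?thesis by (simp only: mult_1)
    qed
  qed
  hence "hardy_poly_norm q a \<le> (exp 1 * ln (real N)) ^ M * hardy_poly_norm q b"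
    using hardy_poly_norm_ln_power[OF q poly_b N, of M] supp' by (auto simp: b_def)
  also have "hardy_poly_norm q b \<le> ln 2 powr - s * hardy_poly_norm q (int_op t a)"
    unfolding b_def
    by (rule hardy_poly_norm_multiplier[OF q dirichlet_multiplier_fractional_integral[OF s] _ poly])
       (use supp' in auto)
  finally show "hardy_poly_norm q a \<le> C * ln (real N) ^ M * hardy_poly_norm q (int_op t a)"
    using N by (simp add: C_def power_mult_distrib mult_ac mult_left_mono)
qed

text \<open>Arbitrary polynomials must be treated, because those approximating a series with first
  coefficient zero need not share this property. Splitting off the first coefficient restores the
  spectral gap and costs at most the norm once more, hence the factor 2.\<close>

lemma hardy_poly_norm_int_op_le:
  assumes q: "q \<ge> 1" and t: "t > 0" and a: "dirichlet_polynomial a"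
  shows "hardy_poly_norm q (int_op t a) \<le> 2 * ln 2 powr - t * hardy_poly_norm q a"
proof -
  define c :: "nat \<Rightarrow> complex" where "c = (\<lambda>n. if n = 1 then a 1 else 0)"
  have c: "dirichlet_polynomial c"
  proof -
    have "{n. c n \<noteq> 0} \<subseteq> {1}" by (auto simp: c_def)
    thus ?thesis by (auto simp: dirichlet_polynomial_def c_def intro: finite_subset)
  qed
  define b where "b = (\<lambda>n. a n - c n)"
  have b: "dirichlet_polynomial b" unfolding b_def by (rule dirichlet_polynomial_diff[OF a c])
  have supp: "n \<in> {2..}" if "b n \<noteq> 0" for n
  proof -
    have "n \<noteq> 0" "n \<noteq> 1" using that dirichlet_polynomial_support[OF b that] by (auto simp: b_def c_def)
    thus ?thesis by auto
  qed
  have "int_op t a = (\<lambda>n. of_real (ln (real n) powr - t) * b n)"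
  proof
    fix n show "int_op t a n = of_real (ln (real n) powr - t) * b n"
      using supp[of n] by (cases "n \<ge> 2") (auto simp: int_op_eq_multiplier b_def c_def)
  qed
  hence "hardy_poly_norm q (int_op t a) \<le> ln 2 powr - t * hardy_poly_norm q b"
    using hardy_poly_norm_multiplier[OF q dirichlet_multiplier_fractional_integral[OF t] _ b] supp by simp
  also have "hardy_poly_norm q b \<le> hardy_poly_norm q a + hardy_poly_norm q c"
    unfolding b_def by (rule hardy_poly_norm_diff[OF q a c])
  also have "hardy_poly_norm q c = cmod (a 1)"
    unfolding c_def using q by (intro hardy_poly_norm_single) auto
  also have "\<dots> \<le> hardy_poly_norm q a" by (rule norm_coefficient_le_hardy_poly_norm[OF q a])
  finally show ?thesis by (simp add: mult_left_mono algebra_simps)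
qed

section \<open>Sufficiency of q <= p\<close>

lemma bounded_int_op:
  assumes "1 \<le> q" "q \<le> p" "\<alpha> > -1" "t > 0"
  shows "bounded_map (hardy_space_0 p) (hardy_norm p) (bergman_space q \<alpha>) (bergman_norm q \<alpha>) (int_op t)"
proof -
  define C where "C = 2 * ln 2 powr - t"
  have C: "C > 0" by (simp add: C_def)
  define m where "m = (\<lambda>n::nat. if n \<ge> 2 then complex_of_real (ln (real n) powr - t) else 0)"
  have op: "int_op t = (\<lambda>a n. m n * a n)" by (simp add: int_op_eq_multiplier m_def fun_eq_iff)
  have bound: "bergman_poly_norm q \<alpha> (\<lambda>n. m n * a n) \<le> C * hardy_poly_norm p a"
    if a: "dirichlet_polynomial a" for a
  proof -
    have "bergman_poly_norm q \<alpha> (\<lambda>n. m n * a n) \<le> hardy_poly_norm q (\<lambda>n. m n * a n)"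
      by (rule bergman_poly_norm_le_hardy_poly_norm[OF assms(1,3) dirichlet_polynomial_mult[OF a]])
    also have "\<dots> \<le> C * hardy_poly_norm q a"
      using hardy_poly_norm_int_op_le[OF assms(1,4) a] by (simp add: op C_def)
    also have "\<dots> \<le> C * hardy_poly_norm p a"
      using C assms by (intro mult_left_mono hardy_poly_norm_mono) auto
    finally show ?thesis .
  qed
  have p: "p \<ge> 1" using assms by simp
  note completion_multiplier[OF hardy_dirichlet_norm[OF p] bergman_dirichlet_norm[OF assms(1,3)] C bound]
  thus ?thesis
    unfolding bounded_map_def op hardy_space_0_def hardy_space_def hardy_norm_def bergman_space_def bergman_norm_def
    by blast
qed

lemma bounded_identity:
  assumes "1 \<le> q" "q \<le> p" "\<beta> > -1"
  shows "bounded_map (hardy_space p) (hardy_norm p) (bergman_space q \<beta>) (bergman_norm q \<beta>) (\<lambda>f. f)"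
proof -
  have bound: "bergman_poly_norm q \<beta> (\<lambda>n. 1 * a n) \<le> 1 * hardy_poly_norm p a"
    if a: "dirichlet_polynomial a" for a
    using bergman_poly_norm_le_hardy_poly_norm[OF assms(1,3) a] hardy_poly_norm_mono[OF assms(1,2), of a] by simp
  have p: "p \<ge> 1" using assms by simp
  note completion_multiplier[OF hardy_dirichlet_norm[OF p] bergman_dirichlet_norm[OF assms(1,3)] zero_less_one bound]
  thus ?thesis
    unfolding bounded_map_def hardy_space_def hardy_norm_def bergman_space_def bergman_norm_def
    by (auto intro!: exI[of _ 1])
qed

section \<open>Necessity of q <= p\<close>

text \<open>On polynomials the completion norms reduce to the polynomial norms. The constant in
  \<open>bounded_map\<close> may be negative, so its absolute value is used.\<close>

lemma bounded_map_hardy_bergman_polynomial: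
  assumes p: "1 \<le> p" and q: "1 \<le> q" and \<beta>: "\<beta> > -1"
    and bdd: "bounded_map X (hardy_norm p) (bergman_space q \<beta>) (bergman_norm q \<beta>) T"
  obtains C where "C \<ge> 0"
    "\<And>f. f \<in> X \<Longrightarrow> dirichlet_polynomial f \<Longrightarrow> dirichlet_polynomial (T f) \<Longrightarrow>
      bergman_poly_norm q \<beta> (T f) \<le> C * hardy_poly_norm p f"
proof -
  interpret H: dirichlet_norm "hardy_poly_norm p" "\<lambda>_. 1" by (rule hardy_dirichlet_norm[OF p])
  interpret B: dirichlet_norm "bergman_poly_norm q \<beta>" "\<lambda>n. ((2 + q * ln (real n)) / 2) powr ((\<beta> + 1) / q)"
    by (rule bergman_dirichlet_norm[OF q \<beta>])
  obtain C where C: "\<And>f. f \<in> X \<Longrightarrow> bergman_norm q \<beta> (T f) \<le> C * hardy_norm p f"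
    using bdd by (auto simp: bounded_map_def)
  have "bergman_poly_norm q \<beta> (T f) \<le> \<bar>C\<bar> * hardy_poly_norm p f"
    if f: "f \<in> X" "dirichlet_polynomial f" "dirichlet_polynomial (T f)" for f
  proof -
    have "bergman_poly_norm q \<beta> (T f) \<le> C * hardy_poly_norm p f"
      using C[OF f(1)] f by (simp add: bergman_norm_def hardy_norm_def B.completion_norm_polynomial H.completion_norm_polynomial)
    also have "\<dots> \<le> \<bar>C\<bar> * hardy_poly_norm p f" by (intro mult_right_mono) (auto simp: hardy_poly_norm_nonneg)
    finally show ?thesis .
  qed
  thus ?thesis by (intro that[of "\<bar>C\<bar>"]) auto
qed

lemma polynomial_in_hardy_space_0:
  assumes "1 \<le> p" "dirichlet_polynomial f" "f 1 = 0"
  shows "f \<in> hardy_space_0 p" "f \<in> hardy_space p"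
  using dirichlet_norm.polynomial_in_completion_space[OF hardy_dirichlet_norm[OF assms(1)] assms(2)] assms(3)
  by (auto simp: hardy_space_0_def hardy_space_def)

lemma bounded_identity_imp_le:
  assumes p: "1 \<le> p" and q: "1 \<le> q" and \<beta>: "\<beta> > -1"
    and bdd: "bounded_map (hardy_space p) (hardy_norm p) (bergman_space q \<beta>) (bergman_norm q \<beta>) (\<lambda>f. f)"
  shows "q \<le> p"
proof (rule ccontr)
  assume "\<not> q \<le> p"
  hence pq: "p < q" by simp
  define \<kappa> where "\<kappa> = (\<beta> + 1) / q"
  have \<kappa>: "\<kappa> > 0" using \<beta> q by (simp add: \<kappa>_def)
  obtain C where C: "C \<ge> 0" "\<And>f. f \<in> hardy_space p \<Longrightarrow> dirichlet_polynomial f \<Longrightarrow>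
      bergman_poly_norm q \<beta> f \<le> C * hardy_poly_norm p f"
    by (rule bounded_map_hardy_bergman_polynomial[OF p q \<beta> bdd]) blast
  obtain f N where f: "dirichlet_polynomial f" "\<And>n. f n \<noteq> 0 \<Longrightarrow> n \<in> {2..N}" "N \<ge> 2"
    "C * ln (real N) ^ 0 * ((2 + q * ln (real N)) / 2) powr \<kappa> * hardy_poly_norm p f < hardy_poly_norm q f"
    \<comment> \<open>The exponent 0 reflects that only shifts have to be undone for the
      identity.\<close>
    using no_polylogarithmic_bound[OF p pq C(1) \<kappa>, of 0] by auto
  have "f 1 = 0" using f(2)[of 1] by auto
  have "hardy_poly_norm q f \<le> ((2 + q * ln (real N)) / 2) powr \<kappa> * bergman_poly_norm q \<beta> f"
    unfolding \<kappa>_def by (rule hardy_poly_norm_le_bergman_poly_norm[OF q \<beta> f(1)]) (use f in auto)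
  also have "\<dots> \<le> ((2 + q * ln (real N)) / 2) powr \<kappa> * (C * hardy_poly_norm p f)"
    using polynomial_in_hardy_space_0[OF p f(1) \<open>f 1 = 0\<close>] f(1) by (intro mult_left_mono C) auto
  finally show False using f(4) by (simp add: mult_ac)
qed

text \<open>As for the identity, with the additional loss D * ln N ^ M from undoing
  \<open>int_op t\<close>. The test function has first coefficient zero and hence lies in the
  domain.\<close>

lemma bounded_int_op_imp_le:
  assumes p: "1 \<le> p" and q: "1 \<le> q" and \<alpha>: "\<alpha> > -1" and t: "t > 0"
    and bdd: "bounded_map (hardy_space_0 p) (hardy_norm p) (bergman_space q \<alpha>) (bergman_norm q \<alpha>) (int_op t)"
  shows "q \<le> p"
proof (rule ccontr)
  assume "\<not> q \<le> p"
  hence pq: "p < q" by simp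
  define \<kappa> where "\<kappa> = (\<alpha> + 1) / q"
  have \<kappa>: "\<kappa> > 0" using \<alpha> q by (simp add: \<kappa>_def)
  have poly: "dirichlet_polynomial (int_op t f)" if "dirichlet_polynomial f" for f
    unfolding int_op_eq_multiplier using that by (rule dirichlet_polynomial_mult)
  obtain C where C: "C \<ge> 0" "\<And>f. f \<in> hardy_space_0 p \<Longrightarrow> dirichlet_polynomial f \<Longrightarrow>
      bergman_poly_norm q \<alpha> (int_op t f) \<le> C * hardy_poly_norm p f"
    by (rule bounded_map_hardy_bergman_polynomial[OF p q \<alpha> bdd]) (use poly in blast)
  obtain D M where D: "D > 0" "\<And>a N. dirichlet_polynomial a \<Longrightarrow> N \<ge> 2 \<Longrightarrow> (\<And>n. a n \<noteq> 0 \<Longrightarrow> n \<in> {2..N}) \<Longrightarrow>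
    hardy_poly_norm q a \<le> D * ln (real N) ^ M * hardy_poly_norm q (int_op t a)"
    by (rule hardy_poly_norm_le_int_op[OF q t]) blast
  have "D * C \<ge> 0" using C(1) D(1) by simp
  from no_polylogarithmic_bound[OF p pq this \<kappa>, of M]
  obtain f N where f: "dirichlet_polynomial f" "\<And>n. f n \<noteq> 0 \<Longrightarrow> n \<in> {2..N}" "N \<ge> 2"
    "D * C * ln (real N) ^ M * ((2 + q * ln (real N)) / 2) powr \<kappa> * hardy_poly_norm p f < hardy_poly_norm q f"
    by auto
  have "f 1 = 0" using f(2)[of 1] by auto
  have lnN: "ln (real N) \<ge> 0" using f(3) by simp
  have "hardy_poly_norm q (int_op t f) \<le> ((2 + q * ln (real N)) / 2) powr \<kappa> * bergman_poly_norm q \<alpha> (int_op t f)"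
    unfolding \<kappa>_def
  proof (rule hardy_poly_norm_le_bergman_poly_norm[OF q \<alpha> poly[OF f(1)]])
    show "n \<le> N" if "int_op t f n \<noteq> 0" for n
      using that f(2)[of n] by (auto simp: int_op_def split: if_splits)
  qed (use f in auto)
  also have "bergman_poly_norm q \<alpha> (int_op t f) \<le> C * hardy_poly_norm p f"
    using polynomial_in_hardy_space_0[OF p f(1) \<open>f 1 = 0\<close>] f(1) by (intro C)
  finally have "hardy_poly_norm q (int_op t f) \<le> ((2 + q * ln (real N)) / 2) powr \<kappa> * (C * hardy_poly_norm p f)"
    by (simp add: mult_left_mono)
  hence "D * ln (real N) ^ M * hardy_poly_norm q (int_op t f) \<le>
      D * ln (real N) ^ M * (((2 + q * ln (real N)) / 2) powr \<kappa> * (C * hardy_poly_norm p f))"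
    using D(1) lnN by (intro mult_left_mono) auto
  moreover have "hardy_poly_norm q f \<le> D * ln (real N) ^ M * hardy_poly_norm q (int_op t f)"
    by (rule D(2)[OF f(1,3,2)])
  ultimately show False using f(4) by (simp add: mult_ac)
qed

theorem theorem4p1:
  fixes p q \<alpha> t :: real
  assumes "1 \<le> p" and "1 \<le> q" and "\<alpha> > -1" and "t > 0"
  shows "(bounded_map (hardy_space_0 p) (hardy_norm p)
            (bergman_space q \<alpha>) (bergman_norm q \<alpha>) (int_op t)
          \<longleftrightarrow> bounded_map (hardy_space p) (hardy_norm p)
            (bergman_space q (\<alpha> + q * t)) (bergman_norm q (\<alpha> + q * t)) (\<lambda>f. f))
       \<and> (bounded_map (hardy_space p) (hardy_norm p)
            (bergman_space q (\<alpha> + q * t)) (bergman_norm q (\<alpha> + q * t)) (\<lambda>f. f)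
          \<longleftrightarrow> p \<ge> q)"
proof -
  have \<beta>: "\<alpha> + q * t > -1" using assms mult_pos_pos[of q t] by linarith
  show ?thesis
    using bounded_int_op[of q p \<alpha> t] bounded_identity[of q p "\<alpha> + q * t"]
      bounded_int_op_imp_le[of p q \<alpha> t] bounded_identity_imp_le[of p q "\<alpha> + q * t"] assms \<beta>
    by blast
qed

end
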